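(* Let $r>0$. Conditioned on the event $\mathcal{E}_0$ and on the serving distance $R=r$, the number $N_l(b(o,r))$ of lines (excluding the typical line $L_0$) whose distance from the origin is smaller than $r$ has probability mass function, for $k=0,1,2,\dots$, $$\mathbb{P}\big(N_l(b(o,r))=k\mid R=r,\mathcal{E}_0\big)=\exp\Big(-2\pi\lambda_l\int_{0}^r e^{-2\lambda_v\sqrt{r^2-y^2}}\,\mathrm{d}y\Big)\,\frac{\Big(2\pi\lambda_l\int_{0}^r e^{-2\lambda_v\sqrt{r^2-y^2}}\,\mathrm{d}y\Big)^k}{k!}.$$
   Context: Fix $\lambda_l,\lambda_v>0$. An undirected line in $\mathbb{R}^2$ is described by $(\theta,\rho)\in[0,2\pi)\times[0,\infty)$, where $\rho$ is its perpendicular distance from the origin $o$ and $\theta$ the angle of the perpendicular with the positive $x$-axis. $\Phi_l$ is the Poisson line process whose $(\theta,\rho)$ points form a homogeneous Poisson point process (PPP) of intensity $\lambda_l$ on $[0,2\pi)\times[0,\infty)$. $L_0$ (the typical line) is an additional line through $o$. Given the lines, each line of $\Phi_l\cup\{L_0\}$ carries an independent homogeneous 1D PPP of intensity $\lambda_v$, whose points are called nodes. The typical receiver is at $o$ and is served by the node nearest to $o$ (on any line); $R$ is its distance from $o$; $\mathcal{E}_0$ is the event that the serving node lies on $L_0$. $b(o,r)$ is the disc of radius $r$ about $o$; $N_l(b(o,r))$ counts the lines of $\Phi_l$ intersecting it. *)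

theory Defs
  imports "HOL-Probability.Probability"
begin

text \<open>Locally finite point configurations, with the sigma-algebra generated by the counts
  in bounded Borel sets; a (simple) point process is a random element of this space.\<close>

definition locally_finite_set :: "'a::euclidean_space set \<Rightarrow> bool" where
  "locally_finite_set X \<longleftrightarrow> (\<forall>B. bounded B \<longrightarrow> finite (X \<inter> B))"

definition config_space :: "'a::euclidean_space set measure" where
  "config_space = sigma {X. locally_finite_set X}
     {{X. locally_finite_set X \<and> card (X \<inter> B) = n} | B n. B \<in> sets borel \<and> bounded B}"

definition homogeneous_ppp ::
  "'w measure \<Rightarrow> real \<Rightarrow> 'a::euclidean_space set \<Rightarrow> ('w \<Rightarrow> 'a set) \<Rightarrow> bool" where
  "homogeneous_ppp M l S \<Phi> \<longleftrightarrow>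
     \<Phi> \<in> measurable M config_space \<and>
     (\<forall>\<omega>\<in>space M. \<Phi> \<omega> \<subseteq> S) \<and>
     (\<forall>B n. B \<in> sets borel \<longrightarrow> bounded B \<longrightarrow> B \<subseteq> S \<longrightarrow>
        \<P>(\<omega> in M. card (\<Phi> \<omega> \<inter> B) = n)
          = exp (- (l * measure lborel B)) * (l * measure lborel B) ^ n / fact n) \<and>
     (\<forall>(m::nat) B. (\<forall>i<m. B i \<in> sets borel \<and> bounded (B i) \<and> B i \<subseteq> S) \<longrightarrow>
        disjoint_family_on B {..<m} \<longrightarrow>
        prob_space.indep_vars M (\<lambda>_. count_space UNIV) (\<lambda>i \<omega>. card (\<Phi> \<omega> \<inter> B i)) {..<m})"

text \<open>Lines of the plane: \<open>(\<theta>, \<rho>)\<close> are the angle and the length of the perpendicular from the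
  origin; \<open>line_point (\<theta>, \<rho>) t\<close> is the point at signed distance \<open>t\<close> from its foot.\<close>

definition line_point :: "real \<times> real \<Rightarrow> real \<Rightarrow> real \<times> real" where
  "line_point p t = (snd p * cos (fst p) - t * sin (fst p), snd p * sin (fst p) + t * cos (fst p))"

definition line_set :: "real \<times> real \<Rightarrow> (real \<times> real) set" where
  "line_set p = range (line_point p)"

text \<open>\<open>L j\<close> (\<open>j = 0, 1, \<dots>\<close>) enumerates, in an arbitrary order, the parameters of the lines of the
  Poisson line process. The process \<open>V i\<close> gives the positions of nodes along a line:
  \<open>V 0\<close> belongs to the typical line and \<open>V (Suc j)\<close> to the line \<open>L j\<close>. Mutual independence of
  the \<open>V i\<close>, and of \<open>V\<close> from \<open>L\<close>, says that given the lines each of them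
  carries an independent Poisson process.\<close>

locale line_cox_network = prob_space M for M :: "'w measure" +
  fixes \<Lambda>\<^sub>l \<Lambda>\<^sub>v :: real
    and L :: "nat \<Rightarrow> 'w \<Rightarrow> real \<times> real"
    and V :: "nat \<Rightarrow> 'w \<Rightarrow> real set"
  assumes intensity_pos: "\<Lambda>\<^sub>l > 0" "\<Lambda>\<^sub>v > 0"
    and lines_measurable: "\<And>j. L j \<in> borel_measurable M"
    and lines_distinct: "\<And>\<omega>. \<omega> \<in> space M \<Longrightarrow> inj (\<lambda>j. L j \<omega>)"
    and lines_ppp: "homogeneous_ppp M \<Lambda>\<^sub>l ({0..<2 * pi} \<times> {0..}) (\<lambda>\<omega>. range (\<lambda>j. L j \<omega>))"
    and nodes_ppp: "\<And>i. homogeneous_ppp M \<Lambda>\<^sub>v UNIV (V i)"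
    and nodes_indep: "indep_vars (\<lambda>_. config_space) V UNIV"
    and lines_nodes_indep:
      "indep_set
         (sets (vimage_algebra (space M) (\<lambda>\<omega> j. L j \<omega>) (PiM UNIV (\<lambda>_. borel))))
         (sets (vimage_algebra (space M) (\<lambda>\<omega> i. V i \<omega>) (PiM UNIV (\<lambda>_. config_space))))"

text \<open>The typical line passes through the origin with arbitrary perpendicular direction \<open>\<theta>\<^sub>0\<close>.\<close>

definition line_param :: "real \<Rightarrow> (nat \<Rightarrow> 'w \<Rightarrow> real \<times> real) \<Rightarrow> nat \<Rightarrow> 'w \<Rightarrow> real \<times> real" where
  "line_param \<theta>\<^sub>0 L i \<omega> = (case i of 0 \<Rightarrow> (\<theta>\<^sub>0, 0) | Suc j \<Rightarrow> L j \<omega>)"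

definition nodes_on ::
  "real \<Rightarrow> (nat \<Rightarrow> 'w \<Rightarrow> real \<times> real) \<Rightarrow> (nat \<Rightarrow> 'w \<Rightarrow> real set) \<Rightarrow> nat \<Rightarrow> 'w \<Rightarrow> (real \<times> real) set" where
  "nodes_on \<theta>\<^sub>0 L V i \<omega> = line_point (line_param \<theta>\<^sub>0 L i \<omega>) ` V i \<omega>"

definition all_nodes ::
  "real \<Rightarrow> (nat \<Rightarrow> 'w \<Rightarrow> real \<times> real) \<Rightarrow> (nat \<Rightarrow> 'w \<Rightarrow> real set) \<Rightarrow> 'w \<Rightarrow> (real \<times> real) set" where
  "all_nodes \<theta>\<^sub>0 L V \<omega> = (\<Union>i. nodes_on \<theta>\<^sub>0 L V i \<omega>)"

definition serving_distance ::
  "real \<Rightarrow> (nat \<Rightarrow> 'w \<Rightarrow> real \<times> real) \<Rightarrow> (nat \<Rightarrow> 'w \<Rightarrow> real set) \<Rightarrow> 'w \<Rightarrow> real" where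
  "serving_distance \<theta>\<^sub>0 L V \<omega> = infdist 0 (all_nodes \<theta>\<^sub>0 L V \<omega>)"

text \<open>The event that the serving node lies on the typical line. Ties between nodes
  have probability zero.\<close>

definition served_by_typical_line ::
  "'w measure \<Rightarrow> real \<Rightarrow> (nat \<Rightarrow> 'w \<Rightarrow> real \<times> real) \<Rightarrow> (nat \<Rightarrow> 'w \<Rightarrow> real set) \<Rightarrow> 'w set" where
  "served_by_typical_line M \<theta>\<^sub>0 L V =
     {\<omega> \<in> space M. \<exists>x \<in> nodes_on \<theta>\<^sub>0 L V 0 \<omega>. \<forall>y \<in> all_nodes \<theta>\<^sub>0 L V \<omega>. dist 0 x \<le> dist 0 y}"

text \<open>Number of lines, the typical one excluded, that hit the open disc of radius \<open>r\<close>,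
  equivalently whose distance from the origin is smaller than \<open>r\<close>.\<close>

definition num_lines :: "(nat \<Rightarrow> 'w \<Rightarrow> real \<times> real) \<Rightarrow> real \<Rightarrow> 'w \<Rightarrow> nat" where
  "num_lines L r \<omega> = card {p \<in> range (\<lambda>j. L j \<omega>). line_set p \<inter> ball 0 r \<noteq> {}}"

definition line_count_pmf :: "real \<Rightarrow> real \<Rightarrow> real \<Rightarrow> nat \<Rightarrow> real" where
  "line_count_pmf \<Lambda>\<^sub>l \<Lambda>\<^sub>v r k =
     exp (- (2 * pi * \<Lambda>\<^sub>l * integral {0..r} (\<lambda>y. exp (- 2 * \<Lambda>\<^sub>v * sqrt (r\<^sup>2 - y\<^sup>2)))))
       * (2 * pi * \<Lambda>\<^sub>l * integral {0..r} (\<lambda>y. exp (- 2 * \<Lambda>\<^sub>v * sqrt (r\<^sup>2 - y\<^sup>2)))) ^ k / fact k"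

text \<open>Conditioning on the null event \<open>R = r\<close> within an event \<open>E\<close>, in two senses.

  \<open>has_cond_prob_at\<close> is pointwise in \<open>r\<close>: the limit of elementary conditional probabilities
  given that \<open>E\<close> occurs and \<open>R\<close> is within \<open>\<epsilon>\<close> of \<open>r\<close>. It forces the
  conditioning events to have positive probability whenever the limit is nonzero.

  \<open>is_cond_prob_version\<close> is the measure-theoretic one: under the law given \<open>E\<close>, the random variable
  \<open>q (R \<omega>)\<close> is a version of the conditional probability, given \<open>R\<close>, of the
  event that \<open>A (R \<omega>)\<close> holds at \<open>\<omega>\<close>.\<close>

definition has_cond_prob_at ::
  "'w measure \<Rightarrow> 'w set \<Rightarrow> ('w \<Rightarrow> real) \<Rightarrow> real \<Rightarrow> ('w \<Rightarrow> bool) \<Rightarrow> real \<Rightarrow> bool" where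
  "has_cond_prob_at M E R r A q \<longleftrightarrow>
     ((\<lambda>\<epsilon>. \<P>(\<omega> in M. A \<omega> \<bar> \<omega> \<in> E \<and> \<bar>R \<omega> - r\<bar> < \<epsilon>)) \<longlongrightarrow> q) (at_right 0)"

definition is_cond_prob_version ::
  "'w measure \<Rightarrow> 'w set \<Rightarrow> ('w \<Rightarrow> real) \<Rightarrow> (real \<Rightarrow> 'w \<Rightarrow> bool) \<Rightarrow> (real \<Rightarrow> real) \<Rightarrow> bool" where
  "is_cond_prob_version M E R A q \<longleftrightarrow>
     (AE \<omega> in uniform_measure M E.
        real_cond_exp (uniform_measure M E) (vimage_algebra (space M) R borel)
          (indicator {\<omega> \<in> space M. A (R \<omega>) \<omega>}) \<omega> = q (R \<omega>))"

end

theory Submission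
  imports Defs
begin

text \<open>Let \<open>D\<^sub>i\<close> be the distance along the \<open>i\<close>-th line from the foot of its perpendicular to its
  nearest node, and \<open>T = D\<^sub>0\<close>. The event \<open>\<E>\<^sub>0\<close> says that every other line has \<open>D\<close> at least the half
  chord \<open>sqrt (T\<^sup>2 - \<rho>\<^sup>2)\<close> it cuts out of the disc of radius \<open>T\<close>, and there \<open>R = T\<close>. Integrating out the
  nodes of the other lines, independent of \<open>T\<close> and of the lines, replaces \<open>\<E>\<^sub>0\<close> by the weight
  \<open>W(s) = \<Prod> exp (- 2 \<lambda>\<^sub>v sqrt (s\<^sup>2 - \<rho>\<^sup>2))\<close>, the product over the lines with \<open>\<rho> < s\<close>, evaluated at \<open>s = T\<close>.
  Cutting the disc into thin annuli and letting their width tend to zero,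
  \<open>E[W(r); N\<^sub>l = k] = exp (- 2 \<pi> \<lambda>\<^sub>l r) (2 \<pi> \<lambda>\<^sub>l I(r))\<^sup>k / k!\<close> with \<open>I(r)\<close> the integral of the statement;
  normalising over \<open>k\<close> gives the Poisson law. The pointwise limit exists because \<open>s \<mapsto> E[W(s); N\<^sub>l = k]\<close>
  is continuous for a fixed disc.\<close>

section \<open>Nearest points, independence and Poisson counts\<close>

text \<open>The value is infinite on the empty set, so a line without nodes needs no separate
  case.\<close>

definition nearest :: "real set \<Rightarrow> ennreal" where
  "nearest X = (INF t\<in>X. ennreal \<bar>t\<bar>)"

lemma nearest_less_iff: "nearest X < a \<longleftrightarrow> (\<exists>t\<in>X. ennreal \<bar>t\<bar> < a)"
  by (simp add: nearest_def INF_less_iff)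

lemma le_nearest_iff: "a \<le> nearest X \<longleftrightarrow> (\<forall>t\<in>X. a \<le> ennreal \<bar>t\<bar>)"
  by (simp add: nearest_def le_INF_iff)

lemma nearest_eq_top_iff: "nearest X = \<top> \<longleftrightarrow> X = {}"
  using nearest_less_iff[of X \<top>] by (auto simp: less_top)

text \<open>Local finiteness leaves only finitely many points no farther out than a chosen one, and
  a minimum over these is a global minimum.\<close>

lemma nearest_attained:
  assumes "locally_finite_set X" "X \<noteq> {}"
  obtains t where "t \<in> X" "nearest X = ennreal \<bar>t\<bar>"
proof -
  obtain u where u: "u \<in> X" using assms by auto
  have fin: "finite (X \<inter> cball 0 \<bar>u\<bar>)"
    using assms(1) bounded_cball unfolding locally_finite_set_def by blast
  have ne: "X \<inter> cball 0 \<bar>u\<bar> \<noteq> {}" using u by auto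
  obtain t where t: "t \<in> X \<inter> cball 0 \<bar>u\<bar>" "\<And>v. v \<in> X \<inter> cball 0 \<bar>u\<bar> \<Longrightarrow> \<bar>t\<bar> \<le> \<bar>v\<bar>"
    using ex_is_arg_min_if_finite[OF fin ne, of abs] by (auto simp: is_arg_min_linorder)
  have min: "\<bar>t\<bar> \<le> \<bar>v\<bar>" if "v \<in> X" for v
    using t(2)[of v] t(1) that by (cases "\<bar>v\<bar> \<le> \<bar>u\<bar>") (auto simp: dist_real_def)
  have "nearest X = ennreal \<bar>t\<bar>"
    unfolding nearest_def by (rule antisym) (use t(1) min in \<open>auto intro!: INF_lower INF_greatest ennreal_leI\<close>)
  with t(1) show ?thesis using that by blast
qed

lemma space_config_space: "space config_space = {X. locally_finite_set X}"
  unfolding config_space_def by (rule space_measure_of) auto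

lemma sets_config_space_card:
  assumes "B \<in> sets borel" "bounded B"
  shows "{X \<in> space config_space. card (X \<inter> B) = n} \<in> sets config_space"
proof -
  have "{{X. locally_finite_set X \<and> card (X \<inter> B) = n} | B n. B \<in> sets borel \<and> bounded B} \<subseteq>
      Pow {X. locally_finite_set (X :: 'a set)}" by auto
  then show ?thesis
    unfolding space_config_space unfolding config_space_def using assms by (auto simp: sets_measure_of)
qed

text \<open>\<open>card\<close> also vanishes on infinite sets; local finiteness and boundedness of
  \<open>B\<close> turn a zero count into emptiness.\<close>

lemma sets_config_space_void:
  assumes "B \<in> sets borel" "bounded B"
  shows "{X \<in> space config_space. X \<inter> B = {}} \<in> sets config_space"
proof -
  have "{X \<in> space config_space. X \<inter> B = {}} = {X \<in> space config_space. card (X \<inter> B) = 0}"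
    using assms(2) by (auto simp: space_config_space locally_finite_set_def)
  then show ?thesis using sets_config_space_card[OF assms] by simp
qed

lemma measurable_nearest [measurable]: "nearest \<in> borel_measurable config_space"
proof (rule borel_measurableI_less)
  fix a :: ennreal
  \<comment> \<open>The sigma-algebra is generated by counts in bounded sets, while \<open>a\<close>
    may be infinite; hence the exhaustion by balls.\<close>
  let ?B = "\<lambda>n::nat. {t::real. ennreal \<bar>t\<bar> < a} \<inter> ball 0 (real n)"
  have "{X \<in> space config_space. nearest X < a} =
      (\<Union>n. space config_space - {X \<in> space config_space. X \<inter> ?B n = {}})"
    using reals_Archimedean2 by (fastforce simp: nearest_less_iff)
  also have "\<dots> \<in> sets config_space"
    by (intro sets.countable_UN image_subsetI sets.compl_sets sets_config_space_void)
      (auto simp: bounded_Int)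
  finally show "{X \<in> space config_space. nearest X < a} \<in> sets config_space" .
qed

text \<open>This is the void probability of an interval of length \<open>2 * u\<close>. The open
  ball matches the weak inequality.\<close>

lemma homogeneous_ppp_le_nearest:
  assumes "homogeneous_ppp M l UNIV \<Phi>" "0 \<le> u"
  shows "\<P>(\<omega> in M. ennreal u \<le> nearest (\<Phi> \<omega>)) = exp (- (2 * l * u))"
proof -
  let ?B = "ball 0 u :: real set"
  have lf: "locally_finite_set (\<Phi> \<omega>)" if "\<omega> \<in> space M" for \<omega>
    using measurable_space[of \<Phi> M config_space \<omega>] assms(1) that
    by (simp add: homogeneous_ppp_def space_config_space)
  have "{\<omega> \<in> space M. ennreal u \<le> nearest (\<Phi> \<omega>)} = {\<omega> \<in> space M. card (\<Phi> \<omega> \<inter> ?B) = 0}"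
    using lf assms(2)
    by (auto simp: le_nearest_iff locally_finite_set_def ennreal_le_iff disjoint_iff not_less)
  moreover have "\<P>(\<omega> in M. card (\<Phi> \<omega> \<inter> ?B) = 0) = exp (- (l * measure lborel ?B))"
    using assms(1)[unfolded homogeneous_ppp_def] by auto
  moreover have "measure lborel ?B = 2 * u"
    using assms(2) by (simp add: ball_eq_greaterThanLessThan)
  ultimately show ?thesis by (simp add: mult_ac)
qed

text \<open>Stated without \<open>indep_var\<close>, which forces both variables to have the same type.\<close>

lemma (in prob_space) nn_integral_indep:
  assumes [measurable]: "X \<in> measurable M S" "Y \<in> measurable M T"
    and ind: "\<And>A B. A \<in> sets S \<Longrightarrow> B \<in> sets T \<Longrightarrow>
      prob ((X -` A \<inter> space M) \<inter> (Y -` B \<inter> space M)) = prob (X -` A \<inter> space M) * prob (Y -` B \<inter> space M)"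
    and f [measurable]: "f \<in> borel_measurable (S \<Otimes>\<^sub>M T)"
  shows "(\<integral>\<^sup>+\<omega>. f (X \<omega>, Y \<omega>) \<partial>M) = (\<integral>\<^sup>+\<omega>. \<integral>\<^sup>+\<omega>'. f (X \<omega>, Y \<omega>') \<partial>M \<partial>M)"
proof -
  interpret X: prob_space "distr M S X" by (rule prob_space_distr) simp
  interpret Y: prob_space "distr M T Y" by (rule prob_space_distr) simp
  have "distr M S X \<Otimes>\<^sub>M distr M T Y = distr M (S \<Otimes>\<^sub>M T) (\<lambda>\<omega>. (X \<omega>, Y \<omega>))"
  proof (rule pair_measure_eqI)
    fix A B assume "A \<in> sets (distr M S X)" "B \<in> sets (distr M T Y)"
    then have [measurable]: "A \<in> sets S" "B \<in> sets T" by simp_all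
    have "(\<lambda>\<omega>. (X \<omega>, Y \<omega>)) -` (A \<times> B) \<inter> space M = (X -` A \<inter> space M) \<inter> (Y -` B \<inter> space M)"
      by auto
    then show "emeasure (distr M S X) A * emeasure (distr M T Y) B
        = emeasure (distr M (S \<Otimes>\<^sub>M T) (\<lambda>\<omega>. (X \<omega>, Y \<omega>))) (A \<times> B)"
      using ind[of A B] by (simp add: emeasure_distr emeasure_eq_measure ennreal_mult[symmetric])
  qed (simp_all add: X.sigma_finite_measure_axioms Y.sigma_finite_measure_axioms)
  then have "(\<integral>\<^sup>+\<omega>. f (X \<omega>, Y \<omega>) \<partial>M) = (\<integral>\<^sup>+z. f z \<partial>(distr M S X \<Otimes>\<^sub>M distr M T Y))"
    by (simp add: nn_integral_distr)
  also have "\<dots> = (\<integral>\<^sup>+x. \<integral>\<^sup>+y. f (x, y) \<partial>distr M T Y \<partial>distr M S X)"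
    by (rule Y.nn_integral_fst[symmetric]) simp
  also have "\<dots> = (\<integral>\<^sup>+\<omega>. \<integral>\<^sup>+y. f (X \<omega>, y) \<partial>distr M T Y \<partial>M)"
    by (subst nn_integral_distr) auto
  also have "\<dots> = (\<integral>\<^sup>+\<omega>. \<integral>\<^sup>+\<omega>'. f (X \<omega>, Y \<omega>') \<partial>M \<partial>M)"
    by (intro nn_integral_cong) (subst nn_integral_distr, auto)
  finally show ?thesis .
qed

text \<open>Weighting a Poisson count by \<open>h ^ n\<close> turns \<open>l ^ n\<close> into
  \<open>(l * h) ^ n\<close> and leaves \<open>exp (- l)\<close> alone: an unnormalised thinning.
  Induction adds one bin at a time; splitting the total between the last bin and the others, the
  binomial theorem adds up the parameters.\<close>

lemma (in prob_space) poisson_weighted_counts: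
  fixes N :: "nat \<Rightarrow> 'a \<Rightarrow> nat" and l h :: "nat \<Rightarrow> real"
  assumes "indep_vars (\<lambda>_. count_space UNIV) N {..<m}"
    and "\<And>i n. i < m \<Longrightarrow> \<P>(\<omega> in M. N i \<omega> = n) = exp (- l i) * l i ^ n / fact n"
    and "\<And>i. i < m \<Longrightarrow> 0 \<le> h i \<and> h i \<le> 1"
  shows "expectation (\<lambda>\<omega>. of_bool ((\<Sum>i<m. N i \<omega>) = k) * (\<Prod>i<m. h i ^ N i \<omega>))
    = exp (- (\<Sum>i<m. l i)) * (\<Sum>i<m. l i * h i) ^ k / fact k"
  using assms
proof (induction m arbitrary: k)
  case 0
  then show ?case by (cases k) (auto simp: prob_space)
next
  case (Suc m)
  have rv[measurable]: "\<And>i. i < Suc m \<Longrightarrow> N i \<in> measurable M (count_space UNIV)"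
    using Suc.prems(1) unfolding indep_vars_def by auto
  define A where "A j \<omega> = of_bool ((\<Sum>i<m. N i \<omega>) = j) * (\<Prod>i<m. h i ^ N i \<omega>)" for j \<omega>
  define B where "B j \<omega> = of_bool (N m \<omega> = j) * h m ^ j" for j \<omega>
  have EA: "expectation (A j) = exp (- (\<Sum>i<m. l i)) * (\<Sum>i<m. l i * h i) ^ j / fact j" for j
    unfolding A_def by (rule Suc.IH) (use Suc.prems in \<open>auto intro: indep_vars_subset\<close>)
  have EB: "expectation (B j) = exp (- l m) * (l m * h m) ^ j / fact j" for j
  proof -
    have "expectation (B j) = h m ^ j * expectation (indicator {\<omega> \<in> space M. N m \<omega> = j})"
      unfolding B_def by (subst integral_mult_right_zero[symmetric], rule Bochner_Integration.integral_cong)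
        (auto simp: indicator_def)
    also have "\<dots> = h m ^ j * (exp (- l m) * l m ^ j / fact j)"
      using Suc.prems(2)[of m j] by simp
    finally show ?thesis by (simp add: power_mult_distrib)
  qed
  have [measurable]: "A j \<in> borel_measurable M" "B j \<in> borel_measurable M" for j
    unfolding A_def B_def by (measurable; simp)+
  have int: "integrable M (A j)" "integrable M (B j)" for j
  proof -
    have "norm (A j \<omega>) \<le> 1" for \<omega>
      unfolding A_def using Suc.prems(3) by (auto simp: abs_prod intro!: prod_le_1 power_le_one)
    then show "integrable M (A j)" by (intro integrable_const_bound[of _ 1]) auto
    have "norm (B j \<omega>) \<le> 1" for \<omega>
      unfolding B_def using Suc.prems(3)[of m] by (auto simp: power_abs intro!: power_le_one)
    then show "integrable M (B j)" by (intro integrable_const_bound[of _ 1]) auto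
  qed
  have ind: "indep_var borel (A i) borel (B j)" for i j
  proof -
    have "indep_var (PiM {..<m} (\<lambda>_. count_space UNIV)) (\<lambda>\<omega>. restrict (\<lambda>i. N i \<omega>) {..<m})
        (PiM {m} (\<lambda>_. count_space UNIV)) (\<lambda>\<omega>. restrict (\<lambda>i. N i \<omega>) {m})"
      by (rule indep_var_restrict[OF Suc.prems(1)]) auto
    \<comment> \<open>To the right of the equality sign, \<open>i\<close> is the fixed index of
      \<open>A i\<close>; the sum and the product bind their own \<open>i\<close>.\<close>
    from indep_var_compose[OF this, where ?Y1.0 = "\<lambda>x. of_bool ((\<Sum>i<m. x i) = i) * (\<Prod>i<m. h i ^ x i)"
      and ?N1.0 = borel and ?Y2.0 = "\<lambda>x. of_bool (x m = j) * h m ^ j" and ?N2.0 = borel]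
    have "indep_var borel ((\<lambda>x. of_bool ((\<Sum>i<m. x i) = i) * (\<Prod>i<m. h i ^ x i)) \<circ> (\<lambda>\<omega>. restrict (\<lambda>i. N i \<omega>) {..<m}))
       borel ((\<lambda>x. of_bool (x m = j) * h m ^ j) \<circ> (\<lambda>\<omega>. restrict (\<lambda>i. N i \<omega>) {m}))"
      by simp
    then show ?thesis by (simp add: A_def[abs_def] B_def[abs_def] o_def)
  qed
  \<comment> \<open>Only the summand whose \<open>j\<close> equals the count in the first
    \<open>m\<close> bins is nonzero; if that count exceeds \<open>k\<close>, both sides
    vanish.\<close>
  have split: "of_bool ((\<Sum>i<Suc m. N i \<omega>) = k) * (\<Prod>i<Suc m. h i ^ N i \<omega>) = (\<Sum>j\<le>k. A j \<omega> * B (k - j) \<omega>)" for \<omega>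
  proof -
    let ?s = "\<Sum>i<m. N i \<omega>"
    have "(\<Sum>j\<le>k. A j \<omega> * B (k - j) \<omega>) = (\<Sum>j\<le>k. if j = ?s then A j \<omega> * B (k - j) \<omega> else 0)"
      by (intro sum.cong) (auto simp: A_def)
    also have "\<dots> = (if ?s \<le> k then A ?s \<omega> * B (k - ?s) \<omega> else 0)" by simp
    also have "\<dots> = of_bool ((\<Sum>i<Suc m. N i \<omega>) = k) * (\<Prod>i<Suc m. h i ^ N i \<omega>)"
      by (auto simp: A_def B_def)
    finally show ?thesis by simp
  qed
  have "expectation (\<lambda>\<omega>. of_bool ((\<Sum>i<Suc m. N i \<omega>) = k) * (\<Prod>i<Suc m. h i ^ N i \<omega>)) =
      (\<Sum>j\<le>k. expectation (A j) * expectation (B (k - j)))"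
    unfolding split
    by (subst Bochner_Integration.integral_sum)
      (simp_all add: indep_var_integrable[OF ind int(1) int(2)] indep_var_lebesgue_integral[OF ind int(1) int(2)])
  also have "\<dots> = (\<Sum>j\<le>k. exp (- (\<Sum>i<Suc m. l i)) / fact k *
      (of_nat (k choose j) * (\<Sum>i<m. l i * h i) ^ j * (l m * h m) ^ (k - j)))"
    unfolding EA EB by (intro sum.cong) (auto simp: binomial_fact exp_diff exp_minus exp_add field_simps)
  also have "\<dots> = exp (- (\<Sum>i<Suc m. l i)) / fact k * (\<Sum>i<Suc m. l i * h i) ^ k"
    by (subst sum_distrib_left[symmetric], subst binomial_ring[symmetric]) simp
  finally show ?case by simp
qed

section \<open>Averages under conditional laws\<close>

context prob_space begin

lemma integral_uniform_measure:
  fixes h :: "'a \<Rightarrow> real"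
  assumes [measurable]: "E \<in> sets M" "h \<in> borel_measurable M" and "prob E \<noteq> 0"
  shows "integral\<^sup>L (uniform_measure M E) h = expectation (\<lambda>\<omega>. indicator E \<omega> * h \<omega>) / prob E"
proof -
  have "uniform_measure M E = density M (\<lambda>\<omega>. ennreal (indicator E \<omega> / prob E))"
    unfolding uniform_measure_def using assms(3)
    by (intro density_cong) (auto simp: indicator_def emeasure_eq_measure divide_ennreal ennreal_1[symmetric]
        zero_less_measure_iff simp del: ennreal_1)
  then have "integral\<^sup>L (uniform_measure M E) h = expectation (\<lambda>\<omega>. (indicator E \<omega> / prob E) *\<^sub>R h \<omega>)"
    by (simp add: integral_density)
  also have "\<dots> = expectation (\<lambda>\<omega>. indicator E \<omega> * h \<omega> / prob E)"
    by simp
  finally show ?thesis by (simp only: integral_divide_zero)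
qed

text \<open>Inside a small window around \<open>r\<close>, continuity keeps
  \<open>\<phi> (T \<omega>)\<close> close to \<open>\<phi> r\<close>, and averaging over the window
  preserves this. Positive window probabilities make the quotient a genuine average.\<close>

lemma tendsto_conditional_average:
  fixes T :: "'a \<Rightarrow> real" and \<phi> :: "real \<Rightarrow> real"
  assumes [measurable]: "T \<in> borel_measurable M" "\<phi> \<in> borel_measurable borel"
    and bound: "\<And>s. \<bar>\<phi> s\<bar> \<le> K" and cont: "isCont \<phi> r"
    and pos: "\<And>\<epsilon>. 0 < \<epsilon> \<Longrightarrow> 0 < \<P>(\<omega> in M. \<bar>T \<omega> - r\<bar> < \<epsilon>)"
  shows "((\<lambda>\<epsilon>. expectation (\<lambda>\<omega>. of_bool (\<bar>T \<omega> - r\<bar> < \<epsilon>) * \<phi> (T \<omega>)) / \<P>(\<omega> in M. \<bar>T \<omega> - r\<bar> < \<epsilon>)) \<longlongrightarrow> \<phi> r) (at_right 0)"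
proof (rule tendstoI)
  fix e :: real assume e: "0 < e"
  \<comment> \<open>Half of \<open>e\<close> is held back because \<open>integral_mono\<close> will
    give only a weak inequality.\<close>
  obtain d where d: "0 < d" "\<And>s. \<bar>s - r\<bar> < d \<Longrightarrow> \<bar>\<phi> s - \<phi> r\<bar> < e / 2"
    using cont e unfolding continuous_at_eps_delta by (metis half_gt_zero dist_real_def)
  have "dist (expectation (\<lambda>\<omega>. of_bool (\<bar>T \<omega> - r\<bar> < \<epsilon>) * \<phi> (T \<omega>)) / \<P>(\<omega> in M. \<bar>T \<omega> - r\<bar> < \<epsilon>)) (\<phi> r) < e"
    if \<epsilon>: "0 < \<epsilon>" "\<epsilon> < d" for \<epsilon>
  proof -
    let ?I = "\<lambda>\<omega>. of_bool (\<bar>T \<omega> - r\<bar> < \<epsilon>) :: real"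
    let ?p = "\<P>(\<omega> in M. \<bar>T \<omega> - r\<bar> < \<epsilon>)"
    have "expectation ?I = expectation (indicator {\<omega> \<in> space M. \<bar>T \<omega> - r\<bar> < \<epsilon>})"
      by (intro Bochner_Integration.integral_cong) (auto simp: indicator_def)
    then have p: "expectation ?I = ?p" by simp
    have int: "integrable M (\<lambda>\<omega>. ?I \<omega> * \<phi> (T \<omega>))" "integrable M (\<lambda>\<omega>. ?I \<omega> * \<phi> r)"
      "integrable M (\<lambda>\<omega>. ?I \<omega> * (\<phi> (T \<omega>) - \<phi> r))" "integrable M (\<lambda>\<omega>. ?I \<omega> * (e / 2))"
    proof -
      have "integrable M ?I" by (intro integrable_const_bound[of _ 1]) auto
      then show "integrable M (\<lambda>\<omega>. ?I \<omega> * \<phi> r)" "integrable M (\<lambda>\<omega>. ?I \<omega> * (e / 2))"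
        by (intro integrable_mult_left; simp)+
      have "K \<ge> 0" using bound[of r] by linarith
      then show "integrable M (\<lambda>\<omega>. ?I \<omega> * \<phi> (T \<omega>))"
        using bound by (auto intro!: integrable_const_bound[of _ K])
      then show "integrable M (\<lambda>\<omega>. ?I \<omega> * (\<phi> (T \<omega>) - \<phi> r))"
        unfolding right_diff_distrib
        using \<open>integrable M (\<lambda>\<omega>. ?I \<omega> * \<phi> r)\<close> by (rule Bochner_Integration.integrable_diff)
    qed
    have "\<bar>expectation (\<lambda>\<omega>. ?I \<omega> * \<phi> (T \<omega>)) - \<phi> r * ?p\<bar> = \<bar>expectation (\<lambda>\<omega>. ?I \<omega> * (\<phi> (T \<omega>) - \<phi> r))\<bar>"
      unfolding right_diff_distrib using int(1,2) p by (simp add: mult.commute)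
    also have "\<dots> \<le> expectation (\<lambda>\<omega>. \<bar>?I \<omega> * (\<phi> (T \<omega>) - \<phi> r)\<bar>)"
      by (rule integral_abs_bound)
    also have "\<dots> \<le> expectation (\<lambda>\<omega>. ?I \<omega> * (e / 2))"
    proof (rule integral_mono)
      show "\<bar>?I \<omega> * (\<phi> (T \<omega>) - \<phi> r)\<bar> \<le> ?I \<omega> * (e / 2)" for \<omega>
        using d(2)[of "T \<omega>"] \<epsilon> by auto
    qed (use int in \<open>auto intro: integrable_abs\<close>)
    also have "\<dots> = e / 2 * ?p" using p by simp
    also have "\<dots> < e * ?p" using pos[OF \<epsilon>(1)] e by simp
    finally have "\<bar>expectation (\<lambda>\<omega>. ?I \<omega> * \<phi> (T \<omega>)) - \<phi> r * ?p\<bar> < e * ?p" .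
    then have "\<bar>expectation (\<lambda>\<omega>. ?I \<omega> * \<phi> (T \<omega>)) - \<phi> r * ?p\<bar> / ?p < e"
      using pos[OF \<epsilon>(1)] by (simp add: pos_divide_less_eq)
    moreover have "expectation (\<lambda>\<omega>. ?I \<omega> * \<phi> (T \<omega>)) / ?p - \<phi> r = (expectation (\<lambda>\<omega>. ?I \<omega> * \<phi> (T \<omega>)) - \<phi> r * ?p) / ?p"
      using pos[OF \<epsilon>(1)] by (simp add: diff_divide_distrib)
    ultimately show ?thesis
      using pos[OF \<epsilon>(1)] by (simp add: dist_real_def abs_divide)
  qed
  then show "\<forall>\<^sub>F \<epsilon> in at_right 0. dist (expectation (\<lambda>\<omega>. of_bool (\<bar>T \<omega> - r\<bar> < \<epsilon>) * \<phi> (T \<omega>)) / \<P>(\<omega> in M. \<bar>T \<omega> - r\<bar> < \<epsilon>)) (\<phi> r) < e"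
    using d(1) by (auto simp: eventually_at_right_field)
qed

end

section \<open>Riemann sums of increasing functions\<close>

lemma integral_mono_on_riemann_bounds:
  fixes h :: "real \<Rightarrow> real"
  assumes mono: "mono_on {0..r} h" and cont: "continuous_on {0..r} h" and n: "0 < n" and r: "0 \<le> r"
  defines "d \<equiv> r / real n"
  shows "d * (\<Sum>i<n. h (real i * d)) \<le> integral {0..r} h"
    and "integral {0..r} h \<le> d * (\<Sum>i<n. h (real (Suc i) * d))"
proof -
  have d0: "0 \<le> d" using r by (simp add: d_def)
  have nd: "real n * d = r" using n by (simp add: d_def)
  have le: "real i * d \<le> r" if "i \<le> n" for i
    using mult_right_mono[of "real i" "real n" d] that d0 nd by simp
  \<comment> \<open>The width \<open>d\<close> stays fixed while the number \<open>m\<close> of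
    cells grows; each cell integral lies between \<open>d\<close> times the values of
    \<open>h\<close> at its two ends.\<close>
  have "d * (\<Sum>i<m. h (real i * d)) \<le> integral {0..real m * d} h \<and>
      integral {0..real m * d} h \<le> d * (\<Sum>i<m. h (real (Suc i) * d))" if "m \<le> n" for m
    using that
  proof (induction m)
    case 0
    then show ?case by simp
  next
    case (Suc m)
    let ?a = "real m * d" and ?b = "real (Suc m) * d"
    have ab: "0 \<le> ?a" "?a \<le> ?b" "?b \<le> r" using d0 le[OF Suc.prems] by (auto simp: algebra_simps)
    have int: "h integrable_on {u..v}" if "0 \<le> u" "v \<le> r" for u v
      using that by (intro integrable_continuous_real continuous_on_subset[OF cont]) auto
    have split: "integral {0..?b} h = integral {0..?a} h + integral {?a..?b} h"
      using Henstock_Kurzweil_Integration.integral_combine[of 0 ?a ?b h] ab int by simp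
    have len: "measure lborel {?a..?b} = d" using ab by (simp add: algebra_simps)
    have "integral {?a..?b} (\<lambda>_. h ?a) \<le> integral {?a..?b} h"
      using ab by (intro integral_le int mono_onD[OF mono]) auto
    then have lo: "d * h ?a \<le> integral {?a..?b} h"
      using len d0 by simp
    have "integral {?a..?b} h \<le> integral {?a..?b} (\<lambda>_. h ?b)"
      using ab by (intro integral_le int mono_onD[OF mono]) auto
    then have up: "integral {?a..?b} h \<le> d * h ?b"
      using len d0 by simp
    from lo up Suc split show ?case by (simp add: distrib_left)
  qed
  from this[of n] show "d * (\<Sum>i<n. h (real i * d)) \<le> integral {0..r} h"
    and "integral {0..r} h \<le> d * (\<Sum>i<n. h (real (Suc i) * d))"
    by (simp_all add: nd)
qed

text \<open>The integral lies between the left and the right sums, and their difference telescopes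
  to \<open>r * (h r - h 0)\<close> divided by the number of cells. Counting cells by
  \<open>Suc n\<close> avoids division by zero.\<close>

lemma mono_on_riemann_limits:
  fixes h :: "real \<Rightarrow> real"
  assumes mono: "mono_on {0..r} h" and cont: "continuous_on {0..r} h" and r: "0 \<le> r"
  defines "d \<equiv> \<lambda>n. r / real (Suc n)"
  shows "(\<lambda>n. d n * (\<Sum>i<Suc n. h (real i * d n))) \<longlonglongrightarrow> integral {0..r} h"
    and "(\<lambda>n. d n * (\<Sum>i<Suc n. h (real (Suc i) * d n))) \<longlonglongrightarrow> integral {0..r} h"
proof -
  define lo up where "lo n = d n * (\<Sum>i<Suc n. h (real i * d n))"
    and "up n = d n * (\<Sum>i<Suc n. h (real (Suc i) * d n))" for n
  have b: "lo n \<le> integral {0..r} h" "integral {0..r} h \<le> up n" for n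
    using integral_mono_on_riemann_bounds[OF mono cont _ r, of "Suc n"]
    unfolding lo_def up_def d_def by auto
  have diff: "up n - lo n = r * (h r - h 0) * inverse (real (Suc n))" for n
  proof -
    have "up n - lo n = d n * (\<Sum>i<Suc n. h (real (Suc i) * d n) - h (real i * d n))"
      unfolding lo_def up_def by (simp only: sum_subtractf right_diff_distrib)
    also have "\<dots> = d n * (h (real (Suc n) * d n) - h 0)"
      by (subst sum_lessThan_telescope) simp
    also have "real (Suc n) * d n = r" by (simp add: d_def)
    finally show ?thesis by (simp add: d_def field_simps)
  qed
  have lo_eq: "integral {0..r} h - r * (h r - h 0) * inverse (real (Suc n)) \<le> lo n"
    and up_eq: "up n \<le> integral {0..r} h + r * (h r - h 0) * inverse (real (Suc n))" for n
    using b[of n] diff[of n] by linarith+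
  have lim: "(\<lambda>n. r * (h r - h 0) * inverse (real (Suc n))) \<longlonglongrightarrow> 0"
    using tendsto_mult_right_zero[OF LIMSEQ_inverse_real_of_nat] .
  have "(\<lambda>n. integral {0..r} h - r * (h r - h 0) * inverse (real (Suc n))) \<longlonglongrightarrow> integral {0..r} h"
    using tendsto_diff[OF tendsto_const lim] by simp
  then have "lo \<longlonglongrightarrow> integral {0..r} h"
    by (rule tendsto_sandwich[OF _ _ _ tendsto_const, rotated 2])
      (use b lo_eq up_eq in \<open>auto intro!: always_eventually\<close>)
  moreover have "(\<lambda>n. integral {0..r} h + r * (h r - h 0) * inverse (real (Suc n))) \<longlonglongrightarrow> integral {0..r} h"
    using tendsto_add[OF tendsto_const lim] by simp
  then have "up \<longlonglongrightarrow> integral {0..r} h"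
    by (rule tendsto_sandwich[OF _ _ tendsto_const, rotated 2])
      (use b lo_eq up_eq in \<open>auto intro!: always_eventually\<close>)
  ultimately show "(\<lambda>n. d n * (\<Sum>i<Suc n. h (real i * d n))) \<longlonglongrightarrow> integral {0..r} h"
    "(\<lambda>n. d n * (\<Sum>i<Suc n. h (real (Suc i) * d n))) \<longlonglongrightarrow> integral {0..r} h"
    by (simp_all add: lo_def[abs_def] up_def[abs_def])
qed

section \<open>The line process weighted by void probabilities\<close>

text \<open>The root of a negative number is negative here, hence the \<open>max\<close>.\<close>

definition half_chord :: "real \<Rightarrow> real \<Rightarrow> real" where
  "half_chord s y = max 0 (sqrt (s\<^sup>2 - y\<^sup>2))"

lemma half_chord_nonneg [simp]: "0 \<le> half_chord s y"
  by (simp add: half_chord_def)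

lemma half_chord_eq_0: "\<bar>s\<bar> \<le> y \<Longrightarrow> half_chord s y = 0"
  by (simp add: half_chord_def abs_le_square_iff[symmetric])

lemma continuous_half_chord [continuous_intros]:
  "continuous_on A f \<Longrightarrow> continuous_on A g \<Longrightarrow> continuous_on A (\<lambda>x. half_chord (f x) (g x))"
  unfolding half_chord_def by (intro continuous_intros)

lemma borel_measurable_half_chord [measurable (raw)]:
  assumes [measurable]: "f \<in> borel_measurable M" "g \<in> borel_measurable M"
  shows "(\<lambda>x. half_chord (f x) (g x)) \<in> borel_measurable M"
  unfolding half_chord_def by measurable

lemma half_chord_antimono: "0 \<le> x \<Longrightarrow> x \<le> y \<Longrightarrow> half_chord s y \<le> half_chord s x"
  unfolding half_chord_def by (intro max.mono real_sqrt_le_mono) (auto intro: power_mono)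

text \<open>A separate constant because a measurability rule for \<open>snd (x j)\<close> itself unifies with every
  \<open>snd (g \<omega>)\<close> and loops.\<close>

definition line_dist :: "(nat \<Rightarrow> real \<times> real) \<Rightarrow> nat \<Rightarrow> real" where
  "line_dist x j = snd (x j)"

lemma borel_measurable_line_dist [measurable (raw)]:
  assumes "f \<in> measurable M (PiM UNIV (\<lambda>_. borel))"
  shows "(\<lambda>\<omega>. line_dist (f \<omega>) j) \<in> borel_measurable M"
  unfolding line_dist_def
  by (rule measurable_compose[OF measurable_compose[OF assms measurable_component_singleton]])
    (auto intro!: borel_measurable_continuous_onI continuous_intros)

text \<open>For the given lines, the probability that none of their nodes falls into the open disc
  of radius \<open>s\<close>. A series over all indices is measurable in \<open>s\<close> and
  \<open>x\<close> together; along the Poisson lines only finitely many terms are nonzero, while for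
  other sequences it may diverge and take a default value.\<close>

definition void_weight :: "real \<Rightarrow> real \<Rightarrow> (nat \<Rightarrow> real \<times> real) \<Rightarrow> real" where
  "void_weight l s x = exp (- (2 * l * (\<Sum>j. half_chord s (line_dist x j))))"

lemma void_weight_pos [simp]: "0 < void_weight l s x"
  by (simp add: void_weight_def)

text \<open>Lines that miss the disc contribute a factor 1. \<open>J\<close> may contain more than
  the lines that hit it, so one index set can serve all radii in a neighbourhood.\<close>

lemma void_weight_eq_prod:
  assumes "finite J" "\<And>j. j \<notin> J \<Longrightarrow> \<bar>s\<bar> \<le> line_dist x j"
  shows "void_weight l s x = (\<Prod>j\<in>J. exp (- (2 * l * half_chord s (line_dist x j))))"
proof -
  have "(\<Sum>j. half_chord s (line_dist x j)) = (\<Sum>j\<in>J. half_chord s (line_dist x j))"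
    using assms by (intro suminf_finite) (auto intro: half_chord_eq_0)
  then show ?thesis
    using assms(1) by (simp add: void_weight_def sum_distrib_left exp_sum sum_negf[symmetric])
qed

lemma borel_measurable_void_weight [measurable (raw)]:
  assumes [measurable]: "f \<in> borel_measurable N" "g \<in> measurable N (PiM UNIV (\<lambda>_. borel))"
  shows "(\<lambda>\<omega>. void_weight l (f \<omega>) (g \<omega>)) \<in> borel_measurable N"
  unfolding void_weight_def by measurable

section \<open>Distances from the origin to lines and to their points\<close>

lemma norm_line_point: "norm (line_point p t) = sqrt ((snd p)\<^sup>2 + t\<^sup>2)"
proof -
  have "(snd p * cos (fst p) - t * sin (fst p))\<^sup>2 + (snd p * sin (fst p) + t * cos (fst p))\<^sup>2
    = ((snd p)\<^sup>2 + t\<^sup>2) * ((sin (fst p))\<^sup>2 + (cos (fst p))\<^sup>2)" by algebra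
  then show ?thesis by (simp add: norm_Pair line_point_def)
qed

text \<open>The point of the line closest to the origin is the foot of the perpendicular, at
  parameter 0.\<close>

lemma line_set_Int_ball_iff: "line_set p \<inter> ball 0 r \<noteq> {} \<longleftrightarrow> \<bar>snd p\<bar> < r"
proof
  assume "line_set p \<inter> ball 0 r \<noteq> {}"
  then obtain t where "sqrt ((snd p)\<^sup>2 + t\<^sup>2) < r"
    by (auto simp: line_set_def norm_line_point)
  moreover have "\<bar>snd p\<bar> \<le> sqrt ((snd p)\<^sup>2 + t\<^sup>2)" by (rule real_le_rsqrt) simp
  ultimately show "\<bar>snd p\<bar> < r" by (rule le_less_trans[rotated])
next
  assume "\<bar>snd p\<bar> < r"
  then have "line_point p 0 \<in> line_set p \<inter> ball 0 r"
    by (auto simp: line_set_def norm_line_point)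
  then show "line_set p \<inter> ball 0 r \<noteq> {}" by blast
qed

text \<open>The right side says that the point at position \<open>v\<close> on a line at distance
  \<open>y\<close> lies outside the open disc of radius \<open>c\<close>. For a line missing the
  disc both sides hold, thanks to the \<open>max\<close> in \<open>half_chord\<close>.\<close>

lemma half_chord_le_iff: "0 \<le> c \<Longrightarrow> half_chord c y \<le> \<bar>v\<bar> \<longleftrightarrow> c \<le> sqrt (y\<^sup>2 + v\<^sup>2)"
proof -
  assume "0 \<le> c"
  have "half_chord c y \<le> \<bar>v\<bar> \<longleftrightarrow> sqrt (c\<^sup>2 - y\<^sup>2) \<le> sqrt (v\<^sup>2)"
    by (simp add: half_chord_def)
  also have "\<dots> \<longleftrightarrow> sqrt (c\<^sup>2) \<le> sqrt (y\<^sup>2 + v\<^sup>2)"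
    unfolding real_sqrt_le_iff by linarith
  finally show ?thesis using \<open>0 \<le> c\<close> by simp
qed

context line_cox_network
begin

text \<open>Bundling the lines into one random sequence allows independence from the nodes to be
  used for a single random element.\<close>

definition lines :: "'w \<Rightarrow> nat \<Rightarrow> real \<times> real" where
  "lines \<omega> = (\<lambda>j. L j \<omega>)"

lemma lines_bounds:
  assumes "\<omega> \<in> space M"
  shows "0 \<le> fst (lines \<omega> j)" "fst (lines \<omega> j) < 2 * pi" "0 \<le> line_dist (lines \<omega>) j"
proof -
  have "range (\<lambda>j. L j \<omega>) \<subseteq> {0..<2 * pi} \<times> {0..}"
    using lines_ppp assms unfolding homogeneous_ppp_def by blast
  then have "L j \<omega> \<in> {0..<2 * pi} \<times> {0..}" by blast
  then show "0 \<le> fst (lines \<omega> j)" "fst (lines \<omega> j) < 2 * pi" "0 \<le> line_dist (lines \<omega>) j"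
    by (auto simp: lines_def line_dist_def mem_Times_iff)
qed

lemma inj_lines: "\<omega> \<in> space M \<Longrightarrow> inj (lines \<omega>)"
  using lines_distinct by (simp add: lines_def)

text \<open>Angles stay below \<open>2 * pi\<close>, so the lines in question have parameters in a
  bounded rectangle, which local finiteness makes finite in number; injectivity carries this over to
  indices.\<close>

lemma finite_lines_near:
  assumes "\<omega> \<in> space M"
  shows "finite {j. line_dist (lines \<omega>) j < s}"
proof -
  have lf: "locally_finite_set (range (lines \<omega>))"
    using measurable_space[of "\<lambda>\<omega>. range (\<lambda>j. L j \<omega>)" M config_space \<omega>] lines_ppp assms
    by (simp add: homogeneous_ppp_def space_config_space lines_def)
  have "bounded ({0..2 * pi} \<times> {0..s})" by (intro bounded_Times) auto
  with lf have fin: "finite (range (lines \<omega>) \<inter> {0..2 * pi} \<times> {0..s})"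
    unfolding locally_finite_set_def by blast
  have "lines \<omega> ` {j. line_dist (lines \<omega>) j < s} \<subseteq> range (lines \<omega>) \<inter> {0..2 * pi} \<times> {0..s}"
  proof (rule image_subsetI)
    fix j assume "j \<in> {j. line_dist (lines \<omega>) j < s}"
    then show "lines \<omega> j \<in> range (lines \<omega>) \<inter> {0..2 * pi} \<times> {0..s}"
      using lines_bounds[OF assms, of j] by (simp add: mem_Times_iff line_dist_def)
  qed
  then show ?thesis
    using finite_imageD[OF finite_subset[OF _ fin]] inj_on_subset[OF inj_lines[OF assms]] by blast
qed

lemma num_lines_eq_card:
  assumes "\<omega> \<in> space M"
  shows "num_lines L r \<omega> = card {j. line_dist (lines \<omega>) j < r}"
proof -
  have "{p \<in> range (\<lambda>j. L j \<omega>). line_set p \<inter> ball 0 r \<noteq> {}} = lines \<omega> ` {j. line_dist (lines \<omega>) j < r}"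
    using lines_bounds(3)[OF assms] by (auto simp: line_set_Int_ball_iff lines_def line_dist_def)
  then show ?thesis
    using card_image[OF inj_on_subset[OF inj_lines[OF assms]]] by (simp add: num_lines_def)
qed

lemma void_weight_lines_le_1:
  assumes "\<omega> \<in> space M"
  shows "void_weight \<Lambda>\<^sub>v s (lines \<omega>) \<le> 1"
  using intensity_pos(2) finite_lines_near[OF assms, of "\<bar>s\<bar>"]
  by (subst void_weight_eq_prod[of "{j. line_dist (lines \<omega>) j < \<bar>s\<bar>}"]) (auto intro!: prod_le_1)

text \<open>For all \<open>s\<close> with absolute value below \<open>\<bar>r\<bar> + 1\<close> the
  same finite set \<open>?J\<close> works, so near \<open>r\<close> the weight is a finite product
  of continuous functions.\<close>

lemma isCont_void_weight_lines:
  assumes "\<omega> \<in> space M"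
  shows "isCont (\<lambda>s. void_weight \<Lambda>\<^sub>v s (lines \<omega>)) r"
proof -
  let ?J = "{j. line_dist (lines \<omega>) j < \<bar>r\<bar> + 1}"
  have "\<forall>\<^sub>F s in nhds r. \<bar>s\<bar> < \<bar>r\<bar> + 1"
    by (rule eventually_nhds_in_open[of "{s. \<bar>s\<bar> < \<bar>r\<bar> + 1}", simplified])
      (auto intro!: open_Collect_less continuous_intros)
  then have "\<forall>\<^sub>F s in nhds r. void_weight \<Lambda>\<^sub>v s (lines \<omega>)
      = (\<Prod>j\<in>?J. exp (- (2 * \<Lambda>\<^sub>v * half_chord s (line_dist (lines \<omega>) j))))"
  proof eventually_elim
    case (elim s)
    then show ?case by (intro void_weight_eq_prod finite_lines_near[OF assms]) auto
  qed
  moreover have "continuous_on UNIV (\<lambda>s. \<Prod>j\<in>?J. exp (- (2 * \<Lambda>\<^sub>v * half_chord s (line_dist (lines \<omega>) j))))"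
    by (intro continuous_intros)
  then have "isCont (\<lambda>s. \<Prod>j\<in>?J. exp (- (2 * \<Lambda>\<^sub>v * half_chord s (line_dist (lines \<omega>) j)))) r"
    by (simp add: continuous_on_eq_continuous_at)
  ultimately show ?thesis by (subst isCont_cong)
qed

lemma measurable_lines [measurable]: "lines \<in> measurable M (PiM UNIV (\<lambda>_. borel))"
  unfolding lines_def using lines_measurable by (intro measurable_PiM_single') auto

section \<open>Closed form of the weighted line count\<close>

definition chord_integral :: "real \<Rightarrow> real" where
  "chord_integral r = integral {0..r} (\<lambda>y. exp (- 2 * \<Lambda>\<^sub>v * sqrt (r\<^sup>2 - y\<^sup>2)))"

definition weighted_count :: "nat \<Rightarrow> real \<Rightarrow> real" where
  "weighted_count k s = expectation (\<lambda>\<omega>. of_bool (num_lines L s \<omega> = k) * void_weight \<Lambda>\<^sub>v s (lines \<omega>))"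

lemma borel_measurable_num_lines [measurable]: "num_lines L r \<in> measurable M (count_space UNIV)"
proof -
  have "(\<lambda>\<omega>. card {j. line_dist (lines \<omega>) j < r}) \<in> measurable M (count_space UNIV)" by measurable
  then show ?thesis by (simp add: num_lines_eq_card cong: measurable_cong)
qed

text \<open>Lines nearer the origin cut longer chords, so the factor \<open>h\<close> of a line
  increases with its distance. Replacing it on each annulus by its value at the inner or the outer
  radius bounds the weight from below or above by products that
  \<open>poisson_weighted_counts\<close> evaluates. Both bounds contain Riemann sums for
  \<open>chord_integral r\<close>, so they share their limit.\<close>

lemma weighted_count_eq:
  assumes r: "0 < r"
  shows "weighted_count k r = exp (- (2 * pi * \<Lambda>\<^sub>l * r)) * (2 * pi * \<Lambda>\<^sub>l * chord_integral r) ^ k / fact k"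
proof -
  define h where "h y = exp (- (2 * \<Lambda>\<^sub>v * half_chord r y))" for y
  define d where "d n = r / real (Suc n)" for n
  define W where "W \<omega> = of_bool (num_lines L r \<omega> = k) * void_weight \<Lambda>\<^sub>v r (lines \<omega>)" for \<omega>
  \<comment> \<open>Annuli in parameter space. The half-open intervals make them disjoint and let
    \<open>Suc n\<close> of them cover the distances in \<open>{0..<r}\<close> exactly.\<close>
  define B where "B n i = {0..<2 * pi} \<times> {real i * d n..<real (Suc i) * d n}" for n i
  define N where "N n i \<omega> = card (range (\<lambda>j. L j \<omega>) \<inter> B n i)" for n i \<omega>
  have d0: "0 < d n" for n using r by (simp add: d_def)
  have nd: "real (Suc n) * d n = r" for n by (simp add: d_def)
  have le_r: "real (Suc i) * d n \<le> r" if "i < Suc n" for i n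
    using mult_right_mono[of "real (Suc i)" "real (Suc n)" "d n"] that d0[of n] nd[of n]
    by (simp del: of_nat_Suc)
  \<comment> \<open>On \<open>{0..r}\<close> the radicand is nonnegative, so
    \<open>half_chord\<close> agrees there with the root in the statement.\<close>
  have chord: "chord_integral r = integral {0..r} h"
    unfolding chord_integral_def h_def
    by (intro Henstock_Kurzweil_Integration.integral_cong) (auto simp: half_chord_def max_def power_mono)
  have h_mono: "h x \<le> h y" if "0 \<le> x" "x \<le> y" for x y
    using half_chord_antimono[OF that] intensity_pos(2) by (simp add: h_def)
  have h01: "0 \<le> h x" "h x \<le> 1" for x
    using intensity_pos(2) by (auto simp: h_def)
  have cont: "continuous_on {0..r} h" unfolding h_def by (intro continuous_intros)
  have mono: "mono_on {0..r} h" using h_mono by (auto simp: mono_on_def)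
  have Bprops: "B n i \<in> sets borel" "bounded (B n i)" "B n i \<subseteq> {0..<2 * pi} \<times> {0..}" for n i
    using d0[of n] unfolding B_def
    by (auto simp: borel_prod[symmetric] intro!: bounded_Times)
      (meson dual_order.trans less_imp_le mult_nonneg_nonneg of_nat_0_le_iff)
  have Bmeas: "measure lborel (B n i) = 2 * pi * d n" for n i
  proof -
    have "emeasure lborel (B n i) = ennreal (2 * pi) * ennreal (real (Suc i) * d n - real i * d n)"
      unfolding B_def lborel_prod[symmetric]
      using d0[of n] by (subst lborel.emeasure_pair_measure_Times) (auto simp: mult_right_mono)
    also have "\<dots> = ennreal (2 * pi * d n)"
      using d0[of n] by (simp add: ennreal_mult[symmetric] algebra_simps)
    finally show ?thesis using d0[of n] by (simp add: measure_def)
  qed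
  have disj: "disjoint_family (B n)" for n
  proof -
    have "i = i'" if "real i * d n \<le> y" "y < real (Suc i) * d n" "real i' * d n \<le> y" "y < real (Suc i') * d n"
      for i i' y
    proof -
      have "real i * d n < real (Suc i') * d n" "real i' * d n < real (Suc i) * d n" using that by linarith+
      then show ?thesis using d0[of n] by simp
    qed
    then have "B n i \<inter> B n i' = {}" if "i \<noteq> i'" for i i'
      unfolding B_def disjoint_iff using that by (metis SigmaE2 atLeastLessThan_iff surj_pair)
    then show ?thesis by (simp add: disjoint_family_on_def)
  qed
  have NP: "\<P>(\<omega> in M. N n i \<omega> = m) = exp (- (2 * pi * \<Lambda>\<^sub>l * d n)) * (2 * pi * \<Lambda>\<^sub>l * d n) ^ m / fact m" for n i m
  proof -
    have "\<P>(\<omega> in M. N n i \<omega> = m) = exp (- (\<Lambda>\<^sub>l * measure lborel (B n i))) * (\<Lambda>\<^sub>l * measure lborel (B n i)) ^ m / fact m"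
      unfolding N_def
      using lines_ppp[unfolded homogeneous_ppp_def, THEN conjunct2, THEN conjunct2, THEN conjunct1] Bprops
      by simp
    then show ?thesis by (simp add: Bmeas mult_ac)
  qed
  have Nind: "indep_vars (\<lambda>_. count_space UNIV) (N n) {..<Suc n}" for n
    unfolding N_def
    using lines_ppp[unfolded homogeneous_ppp_def, THEN conjunct2, THEN conjunct2, THEN conjunct2,
        rule_format, of "Suc n" "B n"] Bprops disjoint_family_on_mono[OF subset_UNIV disj[of n], of "{..<Suc n}"]
    by simp
  have Nrv [measurable]: "N n i \<in> measurable M (count_space UNIV)" if "i < Suc n" for n i
    using Nind that unfolding indep_vars_def by auto
  \<comment> \<open>\<open>g i\<close> will be the inner or the outer radius of annulus
    \<open>i\<close>. The means of the bins add up to \<open>2 * pi * \<Lambda>\<^sub>l * r\<close>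
    because the widths add up to \<open>r\<close>.\<close>
  have mean: "expectation (\<lambda>\<omega>. of_bool ((\<Sum>i<Suc n. N n i \<omega>) = k) * (\<Prod>i<Suc n. h (g i) ^ N n i \<omega>))
      = exp (- (2 * pi * \<Lambda>\<^sub>l * r)) * (2 * pi * \<Lambda>\<^sub>l * (d n * (\<Sum>i<Suc n. h (g i)))) ^ k / fact k" for n g
    using poisson_weighted_counts[OF Nind NP, of n "\<lambda>i. h (g i)" k] h01
    by (simp add: nd[symmetric, of n] sum_distrib_left mult_ac del: sum.lessThan_Suc)
  have fin: "finite (range (lines \<omega>) \<inter> B n i)" if "\<omega> \<in> space M" for \<omega> n i
  proof -
    have "range (lines \<omega>) \<inter> B n i \<subseteq> lines \<omega> ` {j. line_dist (lines \<omega>) j < real (Suc i) * d n}"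
    proof (rule subsetI)
      fix p assume "p \<in> range (lines \<omega>) \<inter> B n i"
      then have "p \<in> range (lines \<omega>)" and "snd p < real (Suc i) * d n"
        by (simp_all only: B_def mem_Times_iff Int_iff atLeastLessThan_iff)
      then obtain j where "p = lines \<omega> j" "snd (lines \<omega> j) < real (Suc i) * d n"
        by blast
      then show "p \<in> lines \<omega> ` {j. line_dist (lines \<omega>) j < real (Suc i) * d n}"
        by (simp add: line_dist_def)
    qed
    then show ?thesis using finite_lines_near[OF that] by (meson finite_imageI finite_subset)
  qed
  have bins: "lines \<omega> ` {j. line_dist (lines \<omega>) j < r} = (\<Union>i<Suc n. range (lines \<omega>) \<inter> B n i)"
    if \<omega>: "\<omega> \<in> space M" for \<omega> n
  proof -
    have "\<exists>i<Suc n. p \<in> B n i" if p: "p \<in> range (lines \<omega>)" "snd p < r" for p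
    proof -
      obtain j where "p = lines \<omega> j" using p(1) by (rule rangeE)
      then have p0: "0 \<le> fst p" "fst p < 2 * pi" "0 \<le> snd p"
        using lines_bounds[OF \<omega>, of j] by (simp_all add: line_dist_def)
      \<comment> \<open>Rounding down the distance in units of the width gives the annulus
        containing the line.\<close>
      define i where "i = nat \<lfloor>snd p / d n\<rfloor>"
      have "0 \<le> snd p / d n" using p0 d0[of n] by simp
      then have "real i = of_int \<lfloor>snd p / d n\<rfloor>" unfolding i_def by (intro of_nat_nat) simp
      then have i: "real i \<le> snd p / d n" "snd p / d n < real (Suc i)"
        using of_int_floor_le[of "snd p / d n"] real_of_int_floor_add_one_gt[of "snd p / d n"]
        unfolding of_nat_Suc by linarith+
      then have ib: "real i * d n \<le> snd p" "snd p < real (Suc i) * d n"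
        using d0[of n] by (simp_all only: pos_le_divide_eq pos_divide_less_eq)
      have "real i * d n < real (Suc n) * d n" using ib(1) p(2) nd[of n] by linarith
      then have "i < Suc n" using d0[of n] by simp
      then show ?thesis using p0 ib by (intro exI[of _ i]) (simp add: B_def mem_Times_iff)
    qed
    moreover have "snd p < r" if "p \<in> B n i" "i < Suc n" for p i
      using that le_r[of i n] unfolding B_def mem_Times_iff atLeastLessThan_iff by linarith
    moreover have "lines \<omega> ` {j. line_dist (lines \<omega>) j < r} = {p \<in> range (lines \<omega>). snd p < r}"
      by (auto simp: line_dist_def)
    ultimately show ?thesis
      by (intro equalityI subsetI) (simp, blast)+
  qed
  have disjoint: "\<forall>i\<in>I. \<forall>j\<in>I. i \<noteq> j \<longrightarrow> (A \<inter> B n i) \<inter> (A \<inter> B n j) = {}" for A I n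
    using disj[of n] unfolding disjoint_family_on_def by blast
  have count: "num_lines L r \<omega> = (\<Sum>i<Suc n. N n i \<omega>)" if \<omega>: "\<omega> \<in> space M" for \<omega> n
  proof -
    have "num_lines L r \<omega> = card (lines \<omega> ` {j. line_dist (lines \<omega>) j < r})"
      using num_lines_eq_card[OF \<omega>] card_image[OF inj_on_subset[OF inj_lines[OF \<omega>]]] by simp
    also have "\<dots> = (\<Sum>i<Suc n. card (range (lines \<omega>) \<inter> B n i))"
      unfolding bins[OF \<omega>, of n] by (rule card_UN_disjoint[OF finite_lessThan _ disjoint]) (simp add: fin[OF \<omega>])
    finally show ?thesis by (simp add: N_def lines_def)
  qed
  have weight: "void_weight \<Lambda>\<^sub>v r (lines \<omega>) = (\<Prod>i<Suc n. \<Prod>p\<in>range (lines \<omega>) \<inter> B n i. h (snd p))"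
    if \<omega>: "\<omega> \<in> space M" for \<omega> n
  proof -
    have "void_weight \<Lambda>\<^sub>v r (lines \<omega>) = (\<Prod>j | line_dist (lines \<omega>) j < r. h (snd (lines \<omega> j)))"
      unfolding h_def using r finite_lines_near[OF \<omega>] 
      by (subst void_weight_eq_prod[of "{j. line_dist (lines \<omega>) j < r}"]) (auto simp: line_dist_def)
    also have "\<dots> = (\<Prod>p\<in>lines \<omega> ` {j. line_dist (lines \<omega>) j < r}. h (snd p))"
      by (subst prod.reindex[OF inj_on_subset[OF inj_lines[OF \<omega>]]]) auto
    also have "\<dots> = (\<Prod>i<Suc n. \<Prod>p\<in>range (lines \<omega>) \<inter> B n i. h (snd p))"
      unfolding bins[OF \<omega>, of n] by (rule prod.UNION_disjoint[OF finite_lessThan _ disjoint]) (simp add: fin[OF \<omega>])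
    finally show ?thesis .
  qed
  have Ncard: "N n i \<omega> = card (range (lines \<omega>) \<inter> B n i)" for n i \<omega>
    by (simp add: N_def lines_def)
  have inB: "real i * d n \<le> snd p" "snd p < real (Suc i) * d n" "0 \<le> snd p"
    if "p \<in> B n i" for p n i
    using that subsetD[OF Bprops(3)[of n i], of p]
    by (simp_all only: B_def mem_Times_iff Int_iff atLeastLessThan_iff atLeast_iff)
  \<comment> \<open>Lines in bin \<open>i\<close> have distance at least
    \<open>real i * d n\<close>, where the increasing \<open>h\<close> takes its smallest value on
    the bin.\<close>
  have lower: "of_bool ((\<Sum>i<Suc n. N n i \<omega>) = k) * (\<Prod>i<Suc n. h (real i * d n) ^ N n i \<omega>) \<le> W \<omega>"
    if \<omega>: "\<omega> \<in> space M" for \<omega> n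
  proof -
    have "h (real i * d n) ^ N n i \<omega> \<le> (\<Prod>p\<in>range (lines \<omega>) \<inter> B n i. h (snd p))" for i
      unfolding Ncard prod_constant[symmetric] using h01 d0[of n]
      by (intro prod_mono conjI h_mono) (simp_all add: inB)
    then show ?thesis
      unfolding W_def count[OF \<omega>, of n] weight[OF \<omega>, of n] using h01
      by (intro mult_left_mono prod_mono) auto
  qed
  have upper: "W \<omega> \<le> of_bool ((\<Sum>i<Suc n. N n i \<omega>) = k) * (\<Prod>i<Suc n. h (real (Suc i) * d n) ^ N n i \<omega>)"
    if \<omega>: "\<omega> \<in> space M" for \<omega> n
  proof -
    have "(\<Prod>p\<in>range (lines \<omega>) \<inter> B n i. h (snd p)) \<le> h (real (Suc i) * d n) ^ N n i \<omega>" for i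
      unfolding Ncard prod_constant[symmetric] using h01
      by (intro prod_mono conjI h_mono less_imp_le[OF inB(2)]) (simp_all, blast intro: inB(3))
    then show ?thesis
      unfolding W_def count[OF \<omega>, of n] weight[OF \<omega>, of n] using h01
      by (intro mult_left_mono prod_mono) (auto intro!: prod_nonneg)
  qed
  have intN: "integrable M (\<lambda>\<omega>. of_bool ((\<Sum>i<Suc n. N n i \<omega>) = k) * (\<Prod>i<Suc n. h (g i) ^ N n i \<omega>))" for n g
  proof (rule integrable_const_bound[of _ 1])
    show "AE \<omega> in M. norm (of_bool ((\<Sum>i<Suc n. N n i \<omega>) = k) * (\<Prod>i<Suc n. h (g i) ^ N n i \<omega>)) \<le> 1"
      using h01 by (intro AE_I2) (auto simp: abs_prod simp del: prod.lessThan_Suc intro!: prod_le_1 power_le_one)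
  qed (measurable; simp)
  have intW: "integrable M W"
    using void_weight_lines_le_1 r unfolding W_def
    by (intro integrable_const_bound[of _ 1]) (auto simp: less_imp_le)
  have lo_le: "exp (- (2 * pi * \<Lambda>\<^sub>l * r)) * (2 * pi * \<Lambda>\<^sub>l * (d n * (\<Sum>i<Suc n. h (real i * d n)))) ^ k / fact k \<le> expectation W" for n
    unfolding mean[symmetric] by (intro integral_mono intN intW lower)
  have le_up: "expectation W \<le> exp (- (2 * pi * \<Lambda>\<^sub>l * r)) * (2 * pi * \<Lambda>\<^sub>l * (d n * (\<Sum>i<Suc n. h (real (Suc i) * d n)))) ^ k / fact k" for n
    unfolding mean[symmetric] by (intro integral_mono intN intW upper)
  note lim = mono_on_riemann_limits[OF mono cont less_imp_le[OF r]]
  have lo_lim: "(\<lambda>n. exp (- (2 * pi * \<Lambda>\<^sub>l * r)) * (2 * pi * \<Lambda>\<^sub>l * (d n * (\<Sum>i<Suc n. h (real i * d n)))) ^ k / fact k)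
      \<longlonglongrightarrow> exp (- (2 * pi * \<Lambda>\<^sub>l * r)) * (2 * pi * \<Lambda>\<^sub>l * integral {0..r} h) ^ k / fact k"
    unfolding d_def by (intro tendsto_intros lim) simp
  have up_lim: "(\<lambda>n. exp (- (2 * pi * \<Lambda>\<^sub>l * r)) * (2 * pi * \<Lambda>\<^sub>l * (d n * (\<Sum>i<Suc n. h (real (Suc i) * d n)))) ^ k / fact k)
      \<longlonglongrightarrow> exp (- (2 * pi * \<Lambda>\<^sub>l * r)) * (2 * pi * \<Lambda>\<^sub>l * integral {0..r} h) ^ k / fact k"
    unfolding d_def by (intro tendsto_intros lim) simp
  have "expectation W = exp (- (2 * pi * \<Lambda>\<^sub>l * r)) * (2 * pi * \<Lambda>\<^sub>l * integral {0..r} h) ^ k / fact k"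
    using lo_le le_up by (intro antisym LIMSEQ_le_const[OF up_lim] LIMSEQ_le_const2[OF lo_lim]) auto
  then show ?thesis by (simp add: weighted_count_def W_def[abs_def] chord)
qed

section \<open>The event of being served by the typical line\<close>

definition node_dist :: "'w \<Rightarrow> nat \<Rightarrow> ennreal" where
  "node_dist \<omega> = (\<lambda>i. nearest (V i \<omega>))"

text \<open>An infinite distance is sent to 0 by \<open>enn2real\<close>;
  \<open>AE_node_dist_finite\<close> shows that this concerns only a null set.\<close>

definition typical_dist :: "'w \<Rightarrow> real" where
  "typical_dist \<omega> = enn2real (node_dist \<omega> 0)"

lemma measurable_V [measurable]: "V i \<in> measurable M config_space"
  using nodes_ppp[of i] by (simp add: homogeneous_ppp_def)

lemma locally_finite_V: "\<omega> \<in> space M \<Longrightarrow> locally_finite_set (V i \<omega>)"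
  using measurable_space[OF measurable_V] by (simp add: space_config_space)

lemma indep_vars_node_dist: "indep_vars (\<lambda>_. borel) (\<lambda>i \<omega>. node_dist \<omega> i) UNIV"
  unfolding node_dist_def by (rule indep_vars_compose2[OF nodes_indep]) simp

lemma measurable_node_dist [measurable]: "node_dist \<in> measurable M (PiM UNIV (\<lambda>_. borel))"
  unfolding node_dist_def by (intro measurable_PiM_single') auto

lemma measurable_node_dist_i [measurable]: "(\<lambda>\<omega>. node_dist \<omega> i) \<in> borel_measurable M"
  unfolding node_dist_def by measurable

lemma measurable_other_dist [measurable]:
  "(\<lambda>\<omega> j. node_dist \<omega> (Suc j)) \<in> measurable M (PiM UNIV (\<lambda>_. borel))"
  by (intro measurable_PiM_single') auto

lemma measurable_typical_dist [measurable]: "typical_dist \<in> borel_measurable M"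
  unfolding typical_dist_def by measurable

lemma typical_dist_nonneg [simp]: "0 \<le> typical_dist \<omega>"
  by (simp add: typical_dist_def)

lemma prob_le_node_dist:
  assumes "0 \<le> u"
  shows "\<P>(\<omega> in M. ennreal u \<le> node_dist \<omega> i) = exp (- (2 * \<Lambda>\<^sub>v * u))"
  using homogeneous_ppp_le_nearest[OF nodes_ppp assms] by (simp add: node_dist_def)

text \<open>An infinite distance exceeds every \<open>n\<close>, so its probability is at most
  \<open>exp (- (2 * \<Lambda>\<^sub>v * real n))\<close> for all \<open>n\<close>.\<close>

lemma AE_node_dist_finite: "AE \<omega> in M. node_dist \<omega> i < \<top>"
proof -
  have "\<P>(\<omega> in M. node_dist \<omega> i = \<top>) \<le> exp (- (2 * \<Lambda>\<^sub>v * real n))" for n :: nat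
  proof -
    have "\<P>(\<omega> in M. node_dist \<omega> i = \<top>) \<le> \<P>(\<omega> in M. ennreal (real n) \<le> node_dist \<omega> i)"
      by (intro finite_measure_mono) auto
    then show ?thesis by (simp add: prob_le_node_dist)
  qed
  moreover have "(\<lambda>n. exp (- (2 * \<Lambda>\<^sub>v * real n))) \<longlonglongrightarrow> 0"
    using intensity_pos by real_asymp
  ultimately have "\<P>(\<omega> in M. node_dist \<omega> i = \<top>) \<le> 0"
    by (intro LIMSEQ_le_const) auto
  then have "\<P>(\<omega> in M. node_dist \<omega> i = \<top>) = 0" by (simp add: measure_le_0_iff)
  then have "AE \<omega> in M. \<not> (node_dist \<omega> i = \<top>)"
    by (subst AE_iff_measurable[OF _ refl]) (auto simp: emeasure_eq_measure)
  then show ?thesis by (simp add: less_top)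
qed

text \<open>\<open>node_dist\<close> is a measurable function of the whole family of node processes,
  so its events belong to the sigma-algebra which that family generates.\<close>

lemma indep_lines_node_dist:
  assumes "A \<in> sets (PiM UNIV (\<lambda>_. borel))" "B \<in> sets (PiM UNIV (\<lambda>_. borel))"
  shows "prob ((lines -` A \<inter> space M) \<inter> (node_dist -` B \<inter> space M))
    = prob (lines -` A \<inter> space M) * prob (node_dist -` B \<inter> space M)"
proof (rule indep_setD[OF lines_nodes_indep])
  have "lines = (\<lambda>\<omega> j. L j \<omega>)" by (simp add: lines_def fun_eq_iff)
  then show "lines -` A \<inter> space M \<in> sets (vimage_algebra (space M) (\<lambda>\<omega> j. L j \<omega>) (PiM UNIV (\<lambda>_. borel)))"
    using assms(1) by (auto intro: in_vimage_algebra)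
  let ?N = "vimage_algebra (space M) (\<lambda>\<omega> i. V i \<omega>) (PiM UNIV (\<lambda>_. config_space))"
  have "(\<lambda>\<omega> i. V i \<omega>) \<in> measurable ?N (PiM UNIV (\<lambda>_. config_space))"
    by (rule measurable_vimage_algebra1) (auto simp: space_PiM intro: measurable_space[OF measurable_V])
  moreover have "(\<lambda>x i. nearest (x i)) \<in> measurable (PiM UNIV (\<lambda>_. config_space)) (PiM UNIV (\<lambda>_::nat. borel))"
    by (intro measurable_PiM_single' measurable_compose[OF _ measurable_nearest]) auto
  ultimately have "(\<lambda>\<omega> i. nearest (V i \<omega>)) \<in> measurable ?N (PiM UNIV (\<lambda>_. borel))"
    by (rule measurable_compose)
  then show "node_dist -` B \<inter> space M \<in> sets ?N"
    using measurable_sets[of node_dist ?N] assms(2) by (simp add: node_dist_def[abs_def])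
qed

text \<open>The index blocks \<open>{0}\<close> and \<open>range Suc\<close> are disjoint, so the
  corresponding groups of node distances are independent; \<open>A'\<close> and \<open>B'\<close>
  carry the events over to the restricted product spaces.\<close>

lemma indep_typical_other:
  assumes [measurable]: "A \<in> sets borel" "B \<in> sets (PiM UNIV (\<lambda>_. borel))"
  shows "prob ((typical_dist -` A \<inter> space M) \<inter> ((\<lambda>\<omega> j. node_dist \<omega> (Suc j)) -` B \<inter> space M))
    = prob (typical_dist -` A \<inter> space M) * prob ((\<lambda>\<omega> j. node_dist \<omega> (Suc j)) -` B \<inter> space M)"
proof -
  let ?P = "PiM {0::nat} (\<lambda>_. borel :: ennreal measure)" and ?Q = "PiM (range Suc) (\<lambda>_. borel :: ennreal measure)"
  define A' where "A' = (\<lambda>x. enn2real (x 0)) -` A \<inter> space ?P"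
  define B' where "B' = (\<lambda>x j. x (Suc j)) -` B \<inter> space ?Q"
  have [measurable]: "(\<lambda>x j. x (Suc j)) \<in> measurable ?Q (PiM UNIV (\<lambda>_::nat. borel))"
    by (intro measurable_PiM_single') auto
  have sets: "A' \<in> sets ?P" "B' \<in> sets ?Q"
    unfolding A'_def B'_def by (rule measurable_sets[OF _ assms(1)] measurable_sets[OF _ assms(2)]; measurable)+
  have "indep_var ?P (\<lambda>\<omega>. restrict (\<lambda>i. node_dist \<omega> i) {0}) ?Q (\<lambda>\<omega>. restrict (\<lambda>i. node_dist \<omega> i) (range Suc))"
    by (rule indep_var_restrict[OF indep_vars_node_dist]) auto
  note ind = indep_varD[OF this sets]
  have "(\<lambda>\<omega>. restrict (\<lambda>i. node_dist \<omega> i) {0}) -` A' \<inter> space M = typical_dist -` A \<inter> space M"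
    by (auto simp: A'_def typical_dist_def space_PiM)
  moreover have "(\<lambda>\<omega>. restrict (\<lambda>i. node_dist \<omega> i) (range Suc)) -` B' \<inter> space M
      = (\<lambda>\<omega> j. node_dist \<omega> (Suc j)) -` B \<inter> space M"
    by (auto simp: B'_def space_PiM)
  moreover have "(\<lambda>\<omega>. (restrict (\<lambda>i. node_dist \<omega> i) {0}, restrict (\<lambda>i. node_dist \<omega> i) (range Suc))) -` (A' \<times> B') \<inter> space M
      = (typical_dist -` A \<inter> space M) \<inter> ((\<lambda>\<omega> j. node_dist \<omega> (Suc j)) -` B \<inter> space M)"
    by (auto simp: A'_def B'_def typical_dist_def space_PiM)
  ultimately show ?thesis using ind by simp
qed

text \<open>Only the finitely many lines hitting the disc impose a condition. Independence of their
  node processes turns the intersection into a product of void probabilities.\<close>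

lemma prob_others_void:
  assumes \<omega>: "\<omega> \<in> space M" and s: "0 \<le> s"
  shows "\<P>(\<omega>' in M. \<forall>j. ennreal (half_chord s (line_dist (lines \<omega>) j)) \<le> node_dist \<omega>' (Suc j))
    = void_weight \<Lambda>\<^sub>v s (lines \<omega>)"
proof -
  let ?J = "{j. line_dist (lines \<omega>) j < s}"
  let ?a = "\<lambda>j. half_chord s (line_dist (lines \<omega>) j)"
  \<comment> \<open>Line \<open>j\<close> carries the nodes with index \<open>Suc j\<close>, hence
    the shift by one.\<close>
  let ?A = "\<lambda>i. {ennreal (?a (i - 1))..}"
  have fin: "finite ?J" using finite_lines_near[OF \<omega>] .
  have zero: "?a j = 0" if "j \<notin> ?J" for j using that s by (auto intro: half_chord_eq_0)
  have eq: "{\<omega>' \<in> space M. \<forall>j. ennreal (?a j) \<le> node_dist \<omega>' (Suc j)}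
      = {\<omega>' \<in> space M. \<forall>j\<in>?J. ennreal (?a j) \<le> node_dist \<omega>' (Suc j)}"
    using zero by (metis (lifting) ennreal_0 zero_le)
  have "prob {\<omega>' \<in> space M. \<forall>j\<in>?J. ennreal (?a j) \<le> node_dist \<omega>' (Suc j)}
      = (\<Prod>j\<in>?J. exp (- (2 * \<Lambda>\<^sub>v * ?a j)))"
  \<comment> \<open>An intersection over no index would be \<open>UNIV\<close> instead of
    \<open>space M\<close>.\<close>
  proof (cases "?J = {}")
    case True
    then show ?thesis by (simp add: prob_space)
  next
    case False
    have "{\<omega>' \<in> space M. \<forall>j\<in>?J. ennreal (?a j) \<le> node_dist \<omega>' (Suc j)}
        = (\<Inter>i\<in>Suc ` ?J. (\<lambda>\<omega>. node_dist \<omega> i) -` ?A i \<inter> space M)"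
      using False by auto
    also have "prob \<dots> = (\<Prod>i\<in>Suc ` ?J. prob ((\<lambda>\<omega>. node_dist \<omega> i) -` ?A i \<inter> space M))"
      using False fin by (intro indep_varsD[OF indep_vars_node_dist]) auto
    also have "\<dots> = (\<Prod>j\<in>?J. prob ((\<lambda>\<omega>. node_dist \<omega> (Suc j)) -` {ennreal (?a j)..} \<inter> space M))"
      by (subst prod.reindex) auto
    also have "\<dots> = (\<Prod>j\<in>?J. exp (- (2 * \<Lambda>\<^sub>v * ?a j)))"
      by (intro prod.cong refl, subst prob_le_node_dist[of "?a _", symmetric])
        (auto intro!: arg_cong[where f = prob])
    finally show ?thesis .
  qed
  then show ?thesis
    unfolding eq using void_weight_eq_prod[of ?J s "lines \<omega>" \<Lambda>\<^sub>v] fin s by simp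
qed

text \<open>Geometrically, the open disc of radius \<open>s\<close> is free of nodes from the lines
  other than the typical one.\<close>

definition unobstructed :: "real \<Rightarrow> (nat \<Rightarrow> real \<times> real) \<Rightarrow> (nat \<Rightarrow> ennreal) \<Rightarrow> bool" where
  "unobstructed s x y \<longleftrightarrow> (\<forall>j. ennreal (half_chord s (line_dist x j)) \<le> y (Suc j))"

lemma measurable_unobstructed [measurable (raw)]:
  assumes [measurable]: "f \<in> borel_measurable N" "g \<in> measurable N (PiM UNIV (\<lambda>_. borel))"
    "h \<in> measurable N (PiM UNIV (\<lambda>_. borel))"
  shows "Measurable.pred N (\<lambda>\<omega>. unobstructed (f \<omega>) (g \<omega>) (h \<omega>))"
proof -
  have [measurable]: "(\<lambda>\<omega>. h \<omega> i) \<in> borel_measurable N" for i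
    by (rule measurable_compose[OF assms(3) measurable_component_singleton]) simp
  show ?thesis unfolding unobstructed_def by measurable
qed

text \<open>Independence is used twice: first the lines are frozen and the nodes averaged, then the
  typical distance is frozen and the other nodes averaged, which yields \<open>void_weight\<close>.
  Exchanging the two remaining integrals puts the typical distance outside.\<close>

lemma nn_integral_unobstructed:
  assumes f [measurable]: "f \<in> borel_measurable (borel \<Otimes>\<^sub>M PiM UNIV (\<lambda>_. borel))"
  shows "(\<integral>\<^sup>+\<omega>. f (typical_dist \<omega>, lines \<omega>) * of_bool (unobstructed (typical_dist \<omega>) (lines \<omega>) (node_dist \<omega>)) \<partial>M)
    = (\<integral>\<^sup>+\<omega>'. \<integral>\<^sup>+\<omega>. f (typical_dist \<omega>', lines \<omega>) * ennreal (void_weight \<Lambda>\<^sub>v (typical_dist \<omega>') (lines \<omega>)) \<partial>M \<partial>M)"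
    (is "?lhs = ?rhs")
proof -
  let ?P = "PiM UNIV (\<lambda>_::nat. borel :: (real \<times> real) measure)"
  let ?Q = "PiM UNIV (\<lambda>_::nat. borel :: ennreal measure)"
  have [measurable]: "(\<lambda>z. enn2real (snd z 0)) \<in> borel_measurable (?P \<Otimes>\<^sub>M ?Q)"
    by (rule measurable_compose[OF measurable_compose[OF measurable_snd measurable_component_singleton]]) auto
  have "?lhs = (\<integral>\<^sup>+\<omega>. (\<lambda>(x, y). f (enn2real (y 0), x) * of_bool (unobstructed (enn2real (y 0)) x y)) (lines \<omega>, node_dist \<omega>) \<partial>M)"
    by (simp add: typical_dist_def)
  also have "\<dots> = (\<integral>\<^sup>+\<omega>. \<integral>\<^sup>+\<omega>'. (\<lambda>(x, y). f (enn2real (y 0), x) * of_bool (unobstructed (enn2real (y 0)) x y)) (lines \<omega>, node_dist \<omega>') \<partial>M \<partial>M)"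
  proof (rule nn_integral_indep[OF measurable_lines measurable_node_dist indep_lines_node_dist])
    show "(\<lambda>(x, y). f (enn2real (y 0), x) * of_bool (unobstructed (enn2real (y 0)) x y)) \<in> borel_measurable (?P \<Otimes>\<^sub>M ?Q)"
      unfolding split_beta' by measurable
  qed
  also have "\<dots> = (\<integral>\<^sup>+\<omega>. \<integral>\<^sup>+\<omega>'. f (typical_dist \<omega>', lines \<omega>) * ennreal (void_weight \<Lambda>\<^sub>v (typical_dist \<omega>') (lines \<omega>)) \<partial>M \<partial>M)"
  proof (rule nn_integral_cong)
    fix \<omega> assume \<omega>: "\<omega> \<in> space M"
    let ?x = "lines \<omega>"
    \<comment> \<open>Here \<open>y\<close> is the already shifted sequence: \<open>y j\<close>
      belongs to line \<open>j\<close>.\<close>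
    let ?F = "\<lambda>(s, y). f (s, ?x) * of_bool (\<forall>j. ennreal (half_chord s (line_dist ?x j)) \<le> y j)"
    have x: "?x \<in> space ?P" using measurable_space[OF measurable_lines \<omega>] .
    have [measurable]: "(\<lambda>z. snd z j) \<in> borel_measurable (borel \<Otimes>\<^sub>M ?Q)" for j
      by (rule measurable_compose[OF measurable_snd measurable_component_singleton]) simp
    note x [measurable]
    have "(\<integral>\<^sup>+\<omega>'. (\<lambda>(x, y). f (enn2real (y 0), x) * of_bool (unobstructed (enn2real (y 0)) x y)) (?x, node_dist \<omega>') \<partial>M)
        = (\<integral>\<^sup>+\<omega>'. ?F (typical_dist \<omega>', \<lambda>j. node_dist \<omega>' (Suc j)) \<partial>M)"
      by (simp add: typical_dist_def unobstructed_def)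
    also have "\<dots> = (\<integral>\<^sup>+\<omega>'. \<integral>\<^sup>+\<omega>''. ?F (typical_dist \<omega>', \<lambda>j. node_dist \<omega>'' (Suc j)) \<partial>M \<partial>M)"
      
    proof (rule nn_integral_indep[OF measurable_typical_dist measurable_other_dist indep_typical_other])
      show "?F \<in> borel_measurable (borel \<Otimes>\<^sub>M ?Q)" unfolding split_beta' by measurable
    qed
    also have "\<dots> = (\<integral>\<^sup>+\<omega>'. f (typical_dist \<omega>', ?x) * ennreal (void_weight \<Lambda>\<^sub>v (typical_dist \<omega>') ?x) \<partial>M)"
    proof (rule nn_integral_cong)
      fix \<omega>' assume "\<omega>' \<in> space M"
      let ?s = "typical_dist \<omega>'"
      let ?U = "{\<omega>'' \<in> space M. \<forall>j. ennreal (half_chord ?s (line_dist ?x j)) \<le> node_dist \<omega>'' (Suc j)}"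
      have "(\<integral>\<^sup>+\<omega>''. ?F (?s, \<lambda>j. node_dist \<omega>'' (Suc j)) \<partial>M) = (\<integral>\<^sup>+\<omega>''. f (?s, ?x) * indicator ?U \<omega>'' \<partial>M)"
        by (intro nn_integral_cong) (auto simp: indicator_def)
      also have "\<dots> = f (?s, ?x) * emeasure M ?U" by (subst nn_integral_cmult_indicator) auto
      also have "\<dots> = f (?s, ?x) * ennreal (void_weight \<Lambda>\<^sub>v ?s ?x)"
        using prob_others_void[OF \<omega>, of ?s] by (simp add: emeasure_eq_measure)
      finally show "(\<integral>\<^sup>+\<omega>''. ?F (?s, \<lambda>j. node_dist \<omega>'' (Suc j)) \<partial>M) = f (?s, ?x) * ennreal (void_weight \<Lambda>\<^sub>v ?s ?x)" .
    qed
    finally show "(\<integral>\<^sup>+\<omega>'. (\<lambda>(x, y). f (enn2real (y 0), x) * of_bool (unobstructed (enn2real (y 0)) x y)) (?x, node_dist \<omega>') \<partial>M)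
      = (\<integral>\<^sup>+\<omega>'. f (typical_dist \<omega>', ?x) * ennreal (void_weight \<Lambda>\<^sub>v (typical_dist \<omega>') ?x) \<partial>M)" .
  qed
  also have "\<dots> = ?rhs"
  proof -
    interpret MM: pair_sigma_finite M M ..
    show ?thesis
      by (intro MM.Fubini'[symmetric]) (unfold split_beta', measurable)
  qed
  finally show ?thesis .
qed

section \<open>The serving node and its distance\<close>

lemma all_nodes_ge_iff:
  assumes "0 \<le> c"
  shows "(\<forall>y\<in>all_nodes \<theta>\<^sub>0 L V \<omega>. c \<le> dist 0 y) \<longleftrightarrow>
    ennreal c \<le> node_dist \<omega> 0 \<and> unobstructed c (lines \<omega>) (node_dist \<omega>)"
proof -
  have split: "(\<forall>i. P i) \<longleftrightarrow> P 0 \<and> (\<forall>j. P (Suc j))" for P :: "nat \<Rightarrow> bool"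
    by (metis not0_implies_Suc)
  have "(\<forall>y\<in>all_nodes \<theta>\<^sub>0 L V \<omega>. c \<le> dist 0 y) \<longleftrightarrow>
      (\<forall>i. \<forall>t\<in>V i \<omega>. c \<le> norm (line_point (line_param \<theta>\<^sub>0 L i \<omega>) t))"
    by (auto simp: all_nodes_def nodes_on_def)
  also have "\<dots> \<longleftrightarrow> (\<forall>t\<in>V 0 \<omega>. c \<le> \<bar>t\<bar>) \<and>
      (\<forall>j. \<forall>t\<in>V (Suc j) \<omega>. c \<le> sqrt ((line_dist (lines \<omega>) j)\<^sup>2 + t\<^sup>2))"
    by (subst split) (simp add: norm_line_point line_param_def line_dist_def lines_def)
  also have "\<dots> \<longleftrightarrow> ennreal c \<le> node_dist \<omega> 0 \<and> unobstructed c (lines \<omega>) (node_dist \<omega>)"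
    using assms by (simp add: node_dist_def unobstructed_def le_nearest_iff half_chord_le_iff)
  finally show ?thesis .
qed

text \<open>A serving node on the typical line is in particular nearest among the nodes of that
  line, so its distance is \<open>node_dist \<omega> 0\<close>. Conversely, if this is finite, local
  finiteness provides a node that attains it.\<close>

lemma served_iff:
  assumes \<omega>: "\<omega> \<in> space M"
  shows "\<omega> \<in> served_by_typical_line M \<theta>\<^sub>0 L V \<longleftrightarrow>
    node_dist \<omega> 0 < \<top> \<and> unobstructed (typical_dist \<omega>) (lines \<omega>) (node_dist \<omega>)"
proof -
  have "\<omega> \<in> served_by_typical_line M \<theta>\<^sub>0 L V \<longleftrightarrow>
      (\<exists>t\<in>V 0 \<omega>. \<forall>y\<in>all_nodes \<theta>\<^sub>0 L V \<omega>. \<bar>t\<bar> \<le> dist 0 y)"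
    using \<omega> by (auto simp: served_by_typical_line_def nodes_on_def norm_line_point line_param_def)
  also have "\<dots> \<longleftrightarrow> (\<exists>t\<in>V 0 \<omega>. ennreal \<bar>t\<bar> \<le> node_dist \<omega> 0 \<and> unobstructed \<bar>t\<bar> (lines \<omega>) (node_dist \<omega>))"
    by (simp only: all_nodes_ge_iff[OF abs_ge_zero])
  also have "\<dots> \<longleftrightarrow> (\<exists>t\<in>V 0 \<omega>. node_dist \<omega> 0 = ennreal \<bar>t\<bar> \<and> unobstructed (typical_dist \<omega>) (lines \<omega>) (node_dist \<omega>))"
  proof -
    have "ennreal \<bar>t\<bar> \<le> node_dist \<omega> 0 \<longleftrightarrow> node_dist \<omega> 0 = ennreal \<bar>t\<bar>" if "t \<in> V 0 \<omega>" for t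
      using that by (auto simp: node_dist_def nearest_def intro: antisym INF_lower)
    then show ?thesis by (auto simp: typical_dist_def)
  qed
  also have "\<dots> \<longleftrightarrow> node_dist \<omega> 0 < \<top> \<and> unobstructed (typical_dist \<omega>) (lines \<omega>) (node_dist \<omega>)"
    using nearest_attained[OF locally_finite_V[OF \<omega>, of 0]] nearest_eq_top_iff[of "V 0 \<omega>"]
    by (auto simp: node_dist_def less_top[symmetric])
  finally show ?thesis .
qed

lemma serving_distance_eq:
  assumes "\<omega> \<in> served_by_typical_line M \<theta>\<^sub>0 L V"
  shows "serving_distance \<theta>\<^sub>0 L V \<omega> = typical_dist \<omega>"
proof -
  have \<omega>: "\<omega> \<in> space M" using assms by (simp add: served_by_typical_line_def)
  have fin: "node_dist \<omega> 0 < \<top>" "unobstructed (typical_dist \<omega>) (lines \<omega>) (node_dist \<omega>)"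
    using assms \<omega> by (simp_all add: served_iff)
  then have ge: "\<forall>y\<in>all_nodes \<theta>\<^sub>0 L V \<omega>. typical_dist \<omega> \<le> dist 0 y"
    by (subst all_nodes_ge_iff) (simp_all add: typical_dist_def)
  have "V 0 \<omega> \<noteq> {}" using fin(1) nearest_eq_top_iff[of "V 0 \<omega>"] by (auto simp: node_dist_def)
  then obtain t where t: "t \<in> V 0 \<omega>" "node_dist \<omega> 0 = ennreal \<bar>t\<bar>"
    using nearest_attained[OF locally_finite_V[OF \<omega>, of 0]] unfolding node_dist_def by metis
  let ?x = "line_point (line_param \<theta>\<^sub>0 L 0 \<omega>) t"
  have x: "?x \<in> all_nodes \<theta>\<^sub>0 L V \<omega>" "dist 0 ?x = typical_dist \<omega>"
    using t unfolding all_nodes_def nodes_on_def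
    by (blast, simp add: norm_line_point line_param_def typical_dist_def)
  have "infdist 0 (all_nodes \<theta>\<^sub>0 L V \<omega>) \<le> typical_dist \<omega>"
    using infdist_le[OF x(1), of 0] x(2) by simp
  moreover have "typical_dist \<omega> \<le> infdist 0 (all_nodes \<theta>\<^sub>0 L V \<omega>)"
    using x(1) ge by (subst infdist_notempty) (auto intro!: cINF_greatest)
  ultimately show ?thesis by (simp add: serving_distance_def)
qed

text \<open>For positive \<open>c\<close>, \<open>all_nodes_ge_iff\<close> describes the event that
  the distance is at least \<open>c\<close>. Since \<open>infdist\<close> to the empty set is 0, the
  existence of a node has to be required as well.\<close>

lemma measurable_serving_distance [measurable]: "serving_distance \<theta>\<^sub>0 L V \<in> borel_measurable M"
proof (rule borel_measurableI_ge)
  fix c :: real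
  have "{\<omega> \<in> space M. c \<le> serving_distance \<theta>\<^sub>0 L V \<omega>} =
      (if c \<le> 0 then space M
       else {\<omega> \<in> space M. (\<exists>i. node_dist \<omega> i < \<top>) \<and> ennreal c \<le> node_dist \<omega> 0 \<and>
         unobstructed c (lines \<omega>) (node_dist \<omega>)})"
  proof (cases "c \<le> 0")
    case True
    then show ?thesis using infdist_nonneg order_trans by (fastforce simp: serving_distance_def)
  next
    case False
    have "c \<le> serving_distance \<theta>\<^sub>0 L V \<omega> \<longleftrightarrow> (\<exists>i. node_dist \<omega> i < \<top>) \<and> ennreal c \<le> node_dist \<omega> 0 \<and>
         unobstructed c (lines \<omega>) (node_dist \<omega>)" for \<omega>
    proof -
      have "all_nodes \<theta>\<^sub>0 L V \<omega> \<noteq> {} \<longleftrightarrow> (\<exists>i. node_dist \<omega> i < \<top>)"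
        by (auto simp: all_nodes_def nodes_on_def node_dist_def less_top[symmetric] nearest_eq_top_iff)
      moreover have "c \<le> infdist 0 A \<longleftrightarrow> A \<noteq> {} \<and> (\<forall>y\<in>A. c \<le> dist 0 y)" for A :: "(real \<times> real) set"
      proof (cases "A = {}")
        case False
        have "bdd_below (dist 0 ` A)" by (rule bdd_belowI2[of _ 0]) simp
        from le_cINF_iff[OF False this, of c] False show ?thesis by (simp add: infdist_notempty)
      qed (use False in \<open>simp add: infdist_def\<close>)
      ultimately show ?thesis
        using False all_nodes_ge_iff[of c \<theta>\<^sub>0 \<omega>] by (simp add: serving_distance_def)
    qed
    with False show ?thesis by simp
  qed
  also have "\<dots> \<in> sets M" by (cases "c \<le> 0") simp_all
  finally show "{\<omega> \<in> space M. c \<le> serving_distance \<theta>\<^sub>0 L V \<omega>} \<in> sets M" .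
qed

lemma sets_served [measurable]: "served_by_typical_line M \<theta>\<^sub>0 L V \<in> sets M"
proof -
  have "served_by_typical_line M \<theta>\<^sub>0 L V =
      {\<omega> \<in> space M. node_dist \<omega> 0 < \<top> \<and> unobstructed (typical_dist \<omega>) (lines \<omega>) (node_dist \<omega>)}"
    using served_iff by (auto simp: served_by_typical_line_def)
  then show ?thesis by simp
qed

section \<open>Conditioning on the serving distance\<close>

text \<open>The radius and the lines are separate arguments with joint measurability, so the random
  serving distance can be inserted as radius.\<close>

definition line_count :: "real \<Rightarrow> (nat \<Rightarrow> real \<times> real) \<Rightarrow> nat" where
  "line_count s x = card {j. line_dist x j < s}"

lemma num_lines_eq_line_count: "\<omega> \<in> space M \<Longrightarrow> num_lines L s \<omega> = line_count s (lines \<omega>)"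
  by (simp add: line_count_def num_lines_eq_card)

lemma measurable_line_count [measurable (raw)]:
  assumes [measurable]: "f \<in> borel_measurable N" "g \<in> measurable N (PiM UNIV (\<lambda>_. borel))"
  shows "(\<lambda>\<omega>. line_count (f \<omega>) (g \<omega>)) \<in> measurable N (count_space UNIV)"
  unfolding line_count_def by measurable

text \<open>The typical distance is frozen at \<open>s\<close> and the lines are averaged.
  \<open>f\<close> may follow \<open>s\<close> or ignore it: the first serves the version of the
  conditional probability, the second the pointwise limit.\<close>

definition void_mean :: "(real \<Rightarrow> (nat \<Rightarrow> real \<times> real) \<Rightarrow> real) \<Rightarrow> real \<Rightarrow> real" where
  "void_mean f s = expectation (\<lambda>\<omega>. f s (lines \<omega>) * void_weight \<Lambda>\<^sub>v s (lines \<omega>))"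

lemma borel_measurable_void_mean [measurable]:
  assumes [measurable]: "(\<lambda>(s, x). f s x) \<in> borel_measurable (borel \<Otimes>\<^sub>M PiM UNIV (\<lambda>_. borel))"
  shows "void_mean f \<in> borel_measurable borel"
proof -
  have [measurable]: "(\<lambda>z. f (fst z) (lines (snd z))) \<in> borel_measurable (borel \<Otimes>\<^sub>M M)"
    using measurable_compose[OF measurable_Pair assms, of fst "borel \<Otimes>\<^sub>M M" "\<lambda>z. lines (snd z)"] by simp
  show ?thesis
    unfolding void_mean_def[abs_def]
    by (rule borel_measurable_lebesgue_integral) (unfold split_beta', measurable)
qed

lemma integrable_void_mean:
  assumes [measurable]: "f s \<in> borel_measurable (PiM UNIV (\<lambda>_. borel))"
    and "\<And>x. 0 \<le> f s x \<and> f s x \<le> 1"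
  shows "integrable M (\<lambda>\<omega>. f s (lines \<omega>) * void_weight \<Lambda>\<^sub>v s (lines \<omega>))"
  using assms(2) void_weight_lines_le_1
  by (intro integrable_const_bound[of _ 1]) (auto simp: abs_mult less_imp_le intro!: mult_le_one)

lemma void_mean_bounds:
  assumes [measurable]: "f s \<in> borel_measurable (PiM UNIV (\<lambda>_. borel))"
    and "\<And>x. 0 \<le> f s x \<and> f s x \<le> 1"
  shows "0 \<le> void_mean f s" "void_mean f s \<le> 1"
proof -
  show "0 \<le> void_mean f s" using assms(2) by (auto simp: void_mean_def less_imp_le intro!: integral_nonneg)
  have "void_mean f s \<le> expectation (\<lambda>_. 1)"
    unfolding void_mean_def using assms void_weight_lines_le_1
    by (intro integral_mono integrable_void_mean) (auto simp: less_imp_le intro!: mult_le_one)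
  then show "void_mean f s \<le> 1" by (simp add: prob_space)
qed

text \<open>Since \<open>g\<close> does not move with \<open>s\<close>, only the weight varies. It
  is continuous for every realisation and bounded by 1, so dominated convergence applies.\<close>

lemma isCont_void_mean:
  assumes [measurable]: "g \<in> borel_measurable (PiM UNIV (\<lambda>_. borel))"
    and g01: "\<And>x. 0 \<le> g x \<and> g x \<le> 1"
  shows "isCont (void_mean (\<lambda>_. g)) r"
  unfolding continuous_at_sequentially o_def void_mean_def
proof (intro allI impI)
  fix X :: "nat \<Rightarrow> real" assume X: "X \<longlonglongrightarrow> r"
  show "(\<lambda>n. expectation (\<lambda>\<omega>. g (lines \<omega>) * void_weight \<Lambda>\<^sub>v (X n) (lines \<omega>)))
      \<longlonglongrightarrow> expectation (\<lambda>\<omega>. g (lines \<omega>) * void_weight \<Lambda>\<^sub>v r (lines \<omega>))"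
  proof (rule integral_dominated_convergence[where w = "\<lambda>_. 1"])
    show "AE \<omega> in M. (\<lambda>n. g (lines \<omega>) * void_weight \<Lambda>\<^sub>v (X n) (lines \<omega>)) \<longlonglongrightarrow> g (lines \<omega>) * void_weight \<Lambda>\<^sub>v r (lines \<omega>)"
      using X isCont_void_weight_lines by (auto intro!: tendsto_mult_left isCont_tendsto_compose[of r "\<lambda>s. void_weight \<Lambda>\<^sub>v s _"])
    show "AE \<omega> in M. norm (g (lines \<omega>) * void_weight \<Lambda>\<^sub>v (X n) (lines \<omega>)) \<le> 1" for n
      using g01 void_weight_lines_le_1 by (auto simp: abs_mult less_imp_le intro!: mult_le_one)
  qed auto
qed

text \<open>The disintegration behind both forms of conditioning. On the event of being served by
  the typical line, the serving distance is \<open>typical_dist\<close>, and almost surely the event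
  is \<open>unobstructed\<close>; \<open>nn_integral_unobstructed\<close> then averages out the
  nodes of the other lines.\<close>

lemma expectation_served:
  fixes f :: "real \<Rightarrow> (nat \<Rightarrow> real \<times> real) \<Rightarrow> real"
  assumes meas: "(\<lambda>(s, x). f s x) \<in> borel_measurable (borel \<Otimes>\<^sub>M PiM UNIV (\<lambda>_. borel))"
    and f01: "\<And>s x. 0 \<le> f s x \<and> f s x \<le> 1"
  shows "expectation (\<lambda>\<omega>. indicator (served_by_typical_line M \<theta>\<^sub>0 L V) \<omega> * f (serving_distance \<theta>\<^sub>0 L V \<omega>) (lines \<omega>))
    = expectation (\<lambda>\<omega>. void_mean f (typical_dist \<omega>))"
proof -
  note [measurable] = borel_measurable_void_mean[OF meas]
  let ?E = "served_by_typical_line M \<theta>\<^sub>0 L V" and ?R = "serving_distance \<theta>\<^sub>0 L V"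
  have comp: "(\<lambda>\<omega>. f (g \<omega>) (lines \<omega>)) \<in> borel_measurable M" if "g \<in> borel_measurable M" for g
    using measurable_compose[OF measurable_Pair[OF that measurable_lines] meas] by simp
  have fs: "f s \<in> borel_measurable (PiM UNIV (\<lambda>_. borel))" for s
    using measurable_compose[OF measurable_Pair[OF measurable_const measurable_ident] meas] by simp
  note [measurable] = comp[OF measurable_serving_distance] comp[OF measurable_typical_dist]
  have "ennreal (expectation (\<lambda>\<omega>. indicator ?E \<omega> * f (?R \<omega>) (lines \<omega>)))
      = (\<integral>\<^sup>+\<omega>. ennreal (indicator ?E \<omega> * f (?R \<omega>) (lines \<omega>)) \<partial>M)"
    using f01 by (intro nn_integral_eq_integral[symmetric] integrable_const_bound[of _ 1])
      (auto simp: indicator_def)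
  also have "\<dots> = (\<integral>\<^sup>+\<omega>. (\<lambda>(s, x). ennreal (f s x)) (typical_dist \<omega>, lines \<omega>) *
      of_bool (unobstructed (typical_dist \<omega>) (lines \<omega>) (node_dist \<omega>)) \<partial>M)"
  proof (rule nn_integral_cong_AE)
    show "AE \<omega> in M. ennreal (indicator ?E \<omega> * f (?R \<omega>) (lines \<omega>)) =
      (\<lambda>(s, x). ennreal (f s x)) (typical_dist \<omega>, lines \<omega>) * of_bool (unobstructed (typical_dist \<omega>) (lines \<omega>) (node_dist \<omega>))"
      using AE_node_dist_finite[of 0] AE_space
    proof eventually_elim
      case (elim \<omega>)
      then show ?case
        using served_iff[of \<omega> \<theta>\<^sub>0] serving_distance_eq[of \<omega> \<theta>\<^sub>0] by (auto simp: indicator_def)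
    qed
  qed
  also have "\<dots> = (\<integral>\<^sup>+\<omega>'. \<integral>\<^sup>+\<omega>. ennreal (f (typical_dist \<omega>') (lines \<omega>)) * ennreal (void_weight \<Lambda>\<^sub>v (typical_dist \<omega>') (lines \<omega>)) \<partial>M \<partial>M)"
    using meas by (subst nn_integral_unobstructed) (auto simp: split_beta')
  also have "\<dots> = (\<integral>\<^sup>+\<omega>'. ennreal (void_mean f (typical_dist \<omega>')) \<partial>M)"
    using f01 unfolding void_mean_def
    by (intro nn_integral_cong) (simp add: ennreal_mult[symmetric] less_imp_le,
      rule nn_integral_eq_integral, auto intro!: integrable_void_mean fs simp: less_imp_le)
  also have "\<dots> = ennreal (expectation (\<lambda>\<omega>. void_mean f (typical_dist \<omega>)))"
    using void_mean_bounds[OF fs f01] by (intro nn_integral_eq_integral integrable_const_bound[of _ 1]) auto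
  finally show ?thesis
    using f01 void_mean_bounds(1)[OF fs f01] by (subst (asm) ennreal_inj) (auto intro!: integral_nonneg)
qed

text \<open>The tail \<open>exp (- (2 * \<Lambda>\<^sub>v * u))\<close> is strictly decreasing, so
  the part of the window just to the left of \<open>r\<close> already has positive mass.\<close>

lemma prob_typical_dist_near:
  assumes r: "0 < r" and \<epsilon>: "0 < \<epsilon>"
  shows "0 < \<P>(\<omega> in M. \<bar>typical_dist \<omega> - r\<bar> < \<epsilon>)"
proof -
  \<comment> \<open>The cut at 0 is for \<open>prob_le_node_dist\<close>, which asks for a
    nonnegative level; half of \<open>\<epsilon>\<close> keeps \<open>a\<close> strictly inside the
    window.\<close>
  define a where "a = max 0 (r - \<epsilon> / 2)"
  have a: "0 \<le> a" "a < r" "r - a < \<epsilon>" using r \<epsilon> by (auto simp: a_def)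
  let ?A = "\<lambda>u. {\<omega> \<in> space M. ennreal u \<le> node_dist \<omega> 0}"
  have "prob (?A r) < prob (?A a)"
    using a r intensity_pos(2) by (simp add: prob_le_node_dist)
  moreover have "?A r \<subseteq> ?A a"
    using ennreal_leI[of a r] a(2) by (auto intro: order_trans)
  ultimately have "0 < prob (?A a - ?A r)"
    by (subst finite_measure_Diff) auto
  also have "\<dots> \<le> \<P>(\<omega> in M. \<bar>typical_dist \<omega> - r\<bar> < \<epsilon>)"
  proof (rule finite_measure_mono)
    show "?A a - ?A r \<subseteq> {\<omega> \<in> space M. \<bar>typical_dist \<omega> - r\<bar> < \<epsilon>}"
    proof
      fix \<omega> assume \<omega>: "\<omega> \<in> ?A a - ?A r"
      then obtain d where d: "node_dist \<omega> 0 = ennreal d" "0 \<le> d"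
        by (cases "node_dist \<omega> 0") auto
      then have "a \<le> d" "d < r" using \<omega> a r by (auto simp: not_le ennreal_less_iff)
      then show "\<omega> \<in> {\<omega> \<in> space M. \<bar>typical_dist \<omega> - r\<bar> < \<epsilon>}"
        using \<omega> d a by (simp add: typical_dist_def)
    qed
  qed simp
  finally show ?thesis .
qed

section \<open>Normalisation to the Poisson law\<close>

abbreviation total_weight :: "real \<Rightarrow> real" where
  "total_weight \<equiv> void_mean (\<lambda>_ _. 1)"

lemma weighted_count_eq_void_mean: "weighted_count k s = void_mean (\<lambda>s x. of_bool (line_count s x = k)) s"
  unfolding weighted_count_def void_mean_def
  by (intro Bochner_Integration.integral_cong) (simp_all add: num_lines_eq_line_count)

lemma borel_measurable_weighted_count [measurable]: "weighted_count k \<in> borel_measurable borel"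
  unfolding weighted_count_eq_void_mean[abs_def]
  by (rule borel_measurable_void_mean) (unfold split_beta', measurable)

text \<open>The partial sum up to \<open>n\<close> is the weight restricted to fewer than
  \<open>n\<close> lines; for each realisation the restriction eventually disappears, and dominated
  convergence applies.\<close>

lemma weighted_count_sums: "(\<lambda>k. weighted_count k s) sums total_weight s"
  unfolding sums_def
proof -
  have int: "integrable M (\<lambda>\<omega>. of_bool (line_count s (lines \<omega>) = k) * void_weight \<Lambda>\<^sub>v s (lines \<omega>))" for k
    by (rule integrable_void_mean[where f = "\<lambda>s x. of_bool (line_count s x = k)"]) auto
  have eq: "(\<Sum>k<n. weighted_count k s)
      = expectation (\<lambda>\<omega>. of_bool (line_count s (lines \<omega>) < n) * void_weight \<Lambda>\<^sub>v s (lines \<omega>))" for n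
  proof -
    have "(\<Sum>k<n. weighted_count k s)
        = expectation (\<lambda>\<omega>. \<Sum>k<n. of_bool (line_count s (lines \<omega>) = k) * void_weight \<Lambda>\<^sub>v s (lines \<omega>))"
      unfolding weighted_count_eq_void_mean void_mean_def using int
      by (intro Bochner_Integration.integral_sum[symmetric])
    also have "\<dots> = expectation (\<lambda>\<omega>. of_bool (line_count s (lines \<omega>) < n) * void_weight \<Lambda>\<^sub>v s (lines \<omega>))"
      unfolding sum_distrib_right[symmetric] of_bool_def by (simp add: sum.delta)
    finally show ?thesis .
  qed
  show "(\<lambda>n. \<Sum>k<n. weighted_count k s) \<longlonglongrightarrow> total_weight s"
    unfolding eq void_mean_def
  proof (rule integral_dominated_convergence[where w = "\<lambda>_. 1"])
    show "AE \<omega> in M. (\<lambda>n. of_bool (line_count s (lines \<omega>) < n) * void_weight \<Lambda>\<^sub>v s (lines \<omega>))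
        \<longlonglongrightarrow> 1 * void_weight \<Lambda>\<^sub>v s (lines \<omega>)"
    proof (rule AE_I2, rule tendsto_eventually)
      fix \<omega>
      show "\<forall>\<^sub>F n in sequentially. of_bool (line_count s (lines \<omega>) < n) * void_weight \<Lambda>\<^sub>v s (lines \<omega>)
          = 1 * void_weight \<Lambda>\<^sub>v s (lines \<omega>)"
        using eventually_gt_at_top[of "line_count s (lines \<omega>)"] by eventually_elim simp
    qed
    show "AE \<omega> in M. norm (of_bool (line_count s (lines \<omega>) < n) * void_weight \<Lambda>\<^sub>v s (lines \<omega>)) \<le> 1" for n
      using void_weight_lines_le_1 by (auto simp: less_imp_le)
  qed auto
qed

lemma total_weight_eq:
  assumes "0 < r"
  shows "total_weight r = exp (- (2 * pi * \<Lambda>\<^sub>l * r)) * exp (2 * pi * \<Lambda>\<^sub>l * chord_integral r)"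
proof (rule sums_unique2[OF weighted_count_sums])
  have "(\<lambda>k. exp (- (2 * pi * \<Lambda>\<^sub>l * r)) * ((2 * pi * \<Lambda>\<^sub>l * chord_integral r) ^ k /\<^sub>R fact k)) sums
      (exp (- (2 * pi * \<Lambda>\<^sub>l * r)) * exp (2 * pi * \<Lambda>\<^sub>l * chord_integral r))"
    by (intro sums_mult exp_converges)
  then show "(\<lambda>k. weighted_count k r) sums
      (exp (- (2 * pi * \<Lambda>\<^sub>l * r)) * exp (2 * pi * \<Lambda>\<^sub>l * chord_integral r))"
    using assms by (simp add: weighted_count_eq divide_inverse mult_ac)
qed

text \<open>The integral over an empty or one-point interval is 0, and
  \<open>0 ^ 0 = 1\<close>.\<close>

lemma line_count_pmf_nonpos: "s \<le> 0 \<Longrightarrow> line_count_pmf \<Lambda>\<^sub>l \<Lambda>\<^sub>v s k = of_bool (k = 0)"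
  by (cases "s = 0"; cases k) (auto simp: line_count_pmf_def)

text \<open>The common factor \<open>exp (- (2 * pi * \<Lambda>\<^sub>l * s))\<close> cancels in the
  ratio of weighted count to total weight. The case \<open>s = 0\<close> is covered because
  \<open>typical_dist\<close> can take that value.\<close>

lemma line_count_pmf_total_weight:
  assumes "0 \<le> s"
  shows "line_count_pmf \<Lambda>\<^sub>l \<Lambda>\<^sub>v s k * total_weight s = weighted_count k s"
proof (cases "s = 0")
  case True
  have "line_count 0 (lines \<omega>) = 0" if "\<omega> \<in> space M" for \<omega>
    using lines_bounds(3)[OF that] by (simp add: line_count_def line_dist_def not_less[symmetric])
  moreover have "half_chord 0 y = 0" for y by (simp add: half_chord_def)
  then have "void_weight \<Lambda>\<^sub>v 0 x = 1" for x by (simp add: void_weight_def)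
  ultimately have "weighted_count k 0 = of_bool (k = 0)" "total_weight 0 = 1"
    unfolding weighted_count_eq_void_mean void_mean_def
    by (simp_all add: prob_space cong: Bochner_Integration.integral_cong)
  with True show ?thesis by (simp add: line_count_pmf_nonpos)
next
  case False
  with assms have s: "0 < s" by simp
  show ?thesis
    unfolding weighted_count_eq[OF s] total_weight_eq[OF s] line_count_pmf_def chord_integral_def[symmetric]
    by (simp add: exp_minus field_simps)
qed

lemma total_weight_pos:
  assumes "0 \<le> s"
  shows "0 < total_weight s"
proof (cases "s = 0")
  case True
  have "half_chord 0 y = 0" for y by (simp add: half_chord_def)
  with True show ?thesis by (simp add: void_mean_def void_weight_def prob_space)
qed (use assms in \<open>simp add: total_weight_eq\<close>)

text \<open>By \<open>expectation_served\<close> this probability is the mean of a strictly positive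
  function of \<open>typical_dist\<close>.\<close>

lemma prob_served_pos: "0 < prob (served_by_typical_line M \<theta>\<^sub>0 L V)"
proof -
  let ?E = "served_by_typical_line M \<theta>\<^sub>0 L V"
  have [measurable]: "total_weight \<in> borel_measurable borel" by (rule borel_measurable_void_mean) simp
  have pos: "0 < total_weight (typical_dist \<omega>)" for \<omega> by (simp add: total_weight_pos)
  have "prob ?E = expectation (\<lambda>\<omega>. total_weight (typical_dist \<omega>))"
    using expectation_served[of "\<lambda>_ _. 1" \<theta>\<^sub>0] by simp
  moreover have "integrable M (\<lambda>\<omega>. total_weight (typical_dist \<omega>))"
    using void_mean_bounds[of "\<lambda>_ _. 1"] by (intro integrable_const_bound[of _ 1]) auto
  then have "expectation (\<lambda>\<omega>. total_weight (typical_dist \<omega>)) \<noteq> 0"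
    using pos by (subst integral_nonneg_eq_0_iff_AE) (auto simp: less_imp_le less_imp_neq[symmetric] AE_False)
  ultimately have "prob ?E \<noteq> 0" by simp
  then show ?thesis by (simp add: zero_less_measure_iff)
qed

text \<open>The numerator and the denominator of the elementary conditional probability are each
  divided by the probability that \<open>typical_dist\<close> lies in the window. Both quotients
  converge by \<open>tendsto_conditional_average\<close>, whose continuity hypothesis holds because
  the disc being counted keeps the radius \<open>r\<close>.\<close>

lemma has_cond_prob_at_line_count:
  assumes r: "0 < r"
  shows "has_cond_prob_at M (served_by_typical_line M \<theta>\<^sub>0 L V) (serving_distance \<theta>\<^sub>0 L V) r
    (\<lambda>\<omega>. num_lines L r \<omega> = k) (line_count_pmf \<Lambda>\<^sub>l \<Lambda>\<^sub>v r k)"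
proof -
  let ?E = "served_by_typical_line M \<theta>\<^sub>0 L V" and ?R = "serving_distance \<theta>\<^sub>0 L V"
  let ?P = "PiM UNIV (\<lambda>_::nat. borel :: (real \<times> real) measure)"
  let ?p = "\<lambda>\<epsilon>. \<P>(\<omega> in M. \<bar>typical_dist \<omega> - r\<bar> < \<epsilon>)"
  \<comment> \<open>\<open>Q\<close> will be the count event for the numerator and the trivial event
    for the denominator.\<close>
  have prob_eq: "\<P>(\<omega> in M. Q (lines \<omega>) \<and> \<omega> \<in> ?E \<and> \<bar>?R \<omega> - r\<bar> < \<epsilon>)
      = expectation (\<lambda>\<omega>. of_bool (\<bar>typical_dist \<omega> - r\<bar> < \<epsilon>) * void_mean (\<lambda>_ x. of_bool (Q x)) (typical_dist \<omega>))"
    if [measurable]: "Measurable.pred ?P Q" for Q \<epsilon>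
  proof -
    have "\<P>(\<omega> in M. Q (lines \<omega>) \<and> \<omega> \<in> ?E \<and> \<bar>?R \<omega> - r\<bar> < \<epsilon>)
        = expectation (indicator {\<omega> \<in> space M. Q (lines \<omega>) \<and> \<omega> \<in> ?E \<and> \<bar>?R \<omega> - r\<bar> < \<epsilon>})"
      by simp
    also have "\<dots> = expectation (\<lambda>\<omega>. indicator ?E \<omega> * (of_bool (\<bar>?R \<omega> - r\<bar> < \<epsilon>) * of_bool (Q (lines \<omega>))))"
      by (intro Bochner_Integration.integral_cong) (auto simp: indicator_def)
    also have "\<dots> = expectation (\<lambda>\<omega>. void_mean (\<lambda>s x. of_bool (\<bar>s - r\<bar> < \<epsilon>) * of_bool (Q x)) (typical_dist \<omega>))"
    proof (rule expectation_served[where f = "\<lambda>s x. of_bool (\<bar>s - r\<bar> < \<epsilon>) * of_bool (Q x)"])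
      show "(\<lambda>(s, x). of_bool (\<bar>s - r\<bar> < \<epsilon>) * of_bool (Q x) :: real) \<in> borel_measurable (borel \<Otimes>\<^sub>M ?P)"
        unfolding split_beta' by measurable
    qed simp
    also have "\<dots> = expectation (\<lambda>\<omega>. of_bool (\<bar>typical_dist \<omega> - r\<bar> < \<epsilon>) * void_mean (\<lambda>_ x. of_bool (Q x)) (typical_dist \<omega>))"
      by (simp add: void_mean_def mult.assoc)
    finally show ?thesis .
  qed
  have lim: "((\<lambda>\<epsilon>. \<P>(\<omega> in M. Q (lines \<omega>) \<and> \<omega> \<in> ?E \<and> \<bar>?R \<omega> - r\<bar> < \<epsilon>) / ?p \<epsilon>)
      \<longlongrightarrow> void_mean (\<lambda>_ x. of_bool (Q x)) r) (at_right 0)"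
    if [measurable]: "Measurable.pred ?P Q" for Q
    unfolding prob_eq[OF that]
  proof (rule tendsto_conditional_average)
    show "void_mean (\<lambda>_ x. of_bool (Q x)) \<in> borel_measurable borel"
      by (rule borel_measurable_void_mean) (unfold split_beta', measurable)
    show "\<bar>void_mean (\<lambda>_ x. of_bool (Q x)) s\<bar> \<le> 1" for s
      using void_mean_bounds[of "\<lambda>_ x. of_bool (Q x)" s] by simp
    show "isCont (void_mean (\<lambda>_ x. of_bool (Q x))) r"
      by (rule isCont_void_mean) auto
  qed (use r prob_typical_dist_near in auto)
  \<comment> \<open>At \<open>s = r\<close> the fixed disc and the moving disc coincide.\<close>
  have num: "void_mean (\<lambda>_ x. of_bool (line_count r x = k)) r = weighted_count k r"
    by (simp add: weighted_count_eq_void_mean void_mean_def)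
  have tot: "void_mean (\<lambda>_ x. of_bool True) r = total_weight r" by simp
  have "((\<lambda>\<epsilon>. (\<P>(\<omega> in M. line_count r (lines \<omega>) = k \<and> \<omega> \<in> ?E \<and> \<bar>?R \<omega> - r\<bar> < \<epsilon>) / ?p \<epsilon>) /
        (\<P>(\<omega> in M. True \<and> \<omega> \<in> ?E \<and> \<bar>?R \<omega> - r\<bar> < \<epsilon>) / ?p \<epsilon>))
      \<longlongrightarrow> weighted_count k r / total_weight r) (at_right 0)"
    using total_weight_pos[of r] r lim[of "\<lambda>x. line_count r x = k"] lim[of "\<lambda>_. True"]
    unfolding num tot by (intro tendsto_divide) auto
  moreover have "weighted_count k r / total_weight r = line_count_pmf \<Lambda>\<^sub>l \<Lambda>\<^sub>v r k"
    using line_count_pmf_total_weight[of r k] total_weight_pos[of r] r by (simp add: field_simps)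
  moreover have "\<forall>\<^sub>F \<epsilon> in at_right 0.
      (\<P>(\<omega> in M. line_count r (lines \<omega>) = k \<and> \<omega> \<in> ?E \<and> \<bar>?R \<omega> - r\<bar> < \<epsilon>) / ?p \<epsilon>) /
        (\<P>(\<omega> in M. True \<and> \<omega> \<in> ?E \<and> \<bar>?R \<omega> - r\<bar> < \<epsilon>) / ?p \<epsilon>)
      = \<P>(\<omega> in M. num_lines L r \<omega> = k \<bar> \<omega> \<in> ?E \<and> \<bar>?R \<omega> - r\<bar> < \<epsilon>)"
    unfolding eventually_at_right_field
  proof (intro exI[of _ 1] conjI allI impI)
    fix \<epsilon> :: real assume "0 < \<epsilon>"
    then have "?p \<epsilon> \<noteq> 0" using prob_typical_dist_near[OF r] by (simp add: less_imp_neq[symmetric])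
    moreover have "{\<omega> \<in> space M. line_count r (lines \<omega>) = k \<and> \<omega> \<in> ?E \<and> \<bar>?R \<omega> - r\<bar> < \<epsilon>}
        = {\<omega> \<in> space M. num_lines L r \<omega> = k \<and> \<omega> \<in> ?E \<and> \<bar>?R \<omega> - r\<bar> < \<epsilon>}"
      by (auto simp: num_lines_eq_line_count)
    ultimately show "(\<P>(\<omega> in M. line_count r (lines \<omega>) = k \<and> \<omega> \<in> ?E \<and> \<bar>?R \<omega> - r\<bar> < \<epsilon>) / ?p \<epsilon>) /
        (\<P>(\<omega> in M. True \<and> \<omega> \<in> ?E \<and> \<bar>?R \<omega> - r\<bar> < \<epsilon>) / ?p \<epsilon>)
      = \<P>(\<omega> in M. num_lines L r \<omega> = k \<bar> \<omega> \<in> ?E \<and> \<bar>?R \<omega> - r\<bar> < \<epsilon>)"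
      by (simp add: cond_prob_def)
  qed simp
  ultimately show ?thesis
    unfolding has_cond_prob_at_def by (simp add: tendsto_cong)
qed

text \<open>It suffices to compare integrals over the events that the serving distance lies in a
  Borel set \<open>B\<close>. By \<open>expectation_served\<close> both become integrals in
  \<open>typical_dist\<close>, and there the integrands agree by
  \<open>line_count_pmf_total_weight\<close>.\<close>

lemma is_cond_prob_version_line_count:
  "is_cond_prob_version M (served_by_typical_line M \<theta>\<^sub>0 L V) (serving_distance \<theta>\<^sub>0 L V)
    (\<lambda>r \<omega>. num_lines L r \<omega> = k) (\<lambda>r. line_count_pmf \<Lambda>\<^sub>l \<Lambda>\<^sub>v r k)"
proof -
  let ?E = "served_by_typical_line M \<theta>\<^sub>0 L V" and ?R = "serving_distance \<theta>\<^sub>0 L V"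
  let ?U = "uniform_measure M ?E" and ?F = "vimage_algebra (space M) ?R borel"
  let ?q = "\<lambda>s. line_count_pmf \<Lambda>\<^sub>l \<Lambda>\<^sub>v s k"
  let ?N = "indicator {\<omega> \<in> space M. num_lines L (?R \<omega>) \<omega> = k} :: 'w \<Rightarrow> real"
  have E: "prob ?E \<noteq> 0" using prob_served_pos[of \<theta>\<^sub>0] by simp
  interpret U: prob_space ?U
    using E by (intro prob_space_uniform_measure) (simp_all add: emeasure_eq_measure)
  have R: "?R \<in> measurable ?F borel" by (rule measurable_vimage_algebra1) simp
  have F: "subalgebra ?U ?F"
    unfolding subalgebra_def by (auto simp: sets_vimage_algebra2)
  interpret finite_measure_subalgebra ?U ?F by unfold_locales (rule F)
  \<comment> \<open>Written as a quotient of weights, the mass function is visibly measurable in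
    \<open>s\<close> and at most 1.\<close>
  have q_eq: "?q s = (if 0 < s then weighted_count k s / total_weight s else of_bool (k = 0))" for s
    using line_count_pmf_total_weight[of s k] total_weight_pos[of s]
    by (auto simp: line_count_pmf_nonpos field_simps)
  have [measurable]: "total_weight \<in> borel_measurable borel" by (rule borel_measurable_void_mean) simp
  have q [measurable]: "?q \<in> borel_measurable borel" unfolding q_eq by measurable
  have q01: "0 \<le> ?q s \<and> ?q s \<le> 1" for s
  proof (cases "0 < s")
    case True
    have "0 \<le> weighted_count k s" "weighted_count k s \<le> total_weight s"
      unfolding weighted_count_eq_void_mean void_mean_def using integrable_void_mean[of "\<lambda>_ _. 1" s]
      by (auto intro!: integral_nonneg integral_mono integrable_void_mean[of "\<lambda>s x. of_bool (line_count s x = k)"]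
          simp: less_imp_le)
    then show ?thesis using True total_weight_pos[of s] by (simp add: q_eq)
  qed (simp add: q_eq)
  have N [measurable]: "{\<omega> \<in> space M. num_lines L (?R \<omega>) \<omega> = k} \<in> sets M"
  proof -
    have "{\<omega> \<in> space M. num_lines L (?R \<omega>) \<omega> = k} = {\<omega> \<in> space M. line_count (?R \<omega>) (lines \<omega>) = k}"
      by (auto simp: num_lines_eq_line_count)
    then show ?thesis by simp
  qed
  have "AE \<omega> in ?U. real_cond_exp ?U ?F ?N \<omega> = ?q (?R \<omega>)"
  proof (rule real_cond_exp_charact)
    fix A assume "A \<in> sets ?F"
    then obtain B where B [measurable]: "B \<in> sets borel" and A: "A = ?R -` B \<inter> space M"
      by (auto simp: sets_vimage_algebra2)
    have [measurable]: "A \<in> sets M" unfolding A by measurable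
    have "expectation (\<lambda>\<omega>. indicator ?E \<omega> * (indicator A \<omega> * ?N \<omega>))
        = expectation (\<lambda>\<omega>. indicator ?E \<omega> * (indicator B (?R \<omega>) * of_bool (line_count (?R \<omega>) (lines \<omega>) = k)))"
      by (intro Bochner_Integration.integral_cong) (auto simp: A indicator_def num_lines_eq_line_count)
    also have "\<dots> = expectation (\<lambda>\<omega>. void_mean (\<lambda>s x. indicator B s * of_bool (line_count s x = k)) (typical_dist \<omega>))"
    proof (rule expectation_served[where f = "\<lambda>s x. indicator B s * of_bool (line_count s x = k)"])
      show "(\<lambda>(s, x). indicator B s * of_bool (line_count s x = k) :: real)
          \<in> borel_measurable (borel \<Otimes>\<^sub>M PiM UNIV (\<lambda>_. borel))"
        unfolding split_beta' by measurable
    qed (simp add: indicator_def)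
    also have "\<dots> = expectation (\<lambda>\<omega>. void_mean (\<lambda>s x. indicator B s * ?q s) (typical_dist \<omega>))"
    proof (intro Bochner_Integration.integral_cong refl)
      fix \<omega>
      let ?s = "typical_dist \<omega>"
      have "void_mean (\<lambda>s x. indicator B s * of_bool (line_count s x = k)) ?s = indicator B ?s * weighted_count k ?s"
        by (simp add: void_mean_def weighted_count_eq_void_mean mult.assoc)
      also have "\<dots> = indicator B ?s * (?q ?s * total_weight ?s)"
        by (simp add: line_count_pmf_total_weight)
      also have "\<dots> = void_mean (\<lambda>s x. indicator B s * ?q s) ?s"
        by (simp add: void_mean_def mult.assoc)
      finally show "void_mean (\<lambda>s x. indicator B s * of_bool (line_count s x = k)) ?s
        = void_mean (\<lambda>s x. indicator B s * ?q s) ?s" .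
    qed
    also have "\<dots> = expectation (\<lambda>\<omega>. indicator ?E \<omega> * (indicator B (?R \<omega>) * ?q (?R \<omega>)))"
    proof (rule expectation_served[where f = "\<lambda>s x. indicator B s * ?q s", symmetric])
      show "(\<lambda>(s, x). indicator B s * ?q s :: real) \<in> borel_measurable (borel \<Otimes>\<^sub>M PiM UNIV (\<lambda>_. borel))"
        unfolding split_beta' by measurable
    qed (use q01 in \<open>simp add: indicator_def\<close>)
    also have "\<dots> = expectation (\<lambda>\<omega>. indicator ?E \<omega> * (indicator A \<omega> * ?q (?R \<omega>)))"
      by (intro Bochner_Integration.integral_cong) (auto simp: A indicator_def)
    finally show "(\<integral>\<omega>\<in>A. ?N \<omega> \<partial>?U) = (\<integral>\<omega>\<in>A. ?q (?R \<omega>) \<partial>?U)"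
      using E by (simp add: set_lebesgue_integral_def integral_uniform_measure)
  next
    show "integrable ?U ?N" by (intro U.integrable_const_bound[of _ 1]) (auto simp: indicator_def)
    show "integrable ?U (\<lambda>\<omega>. ?q (?R \<omega>))" using q01 by (intro U.integrable_const_bound[of _ 1]) auto
    show "(\<lambda>\<omega>. ?q (?R \<omega>)) \<in> borel_measurable ?F" by (rule measurable_compose[OF R q])
  qed
  then show ?thesis by (simp add: is_cond_prob_version_def)
qed

end

theorem corollary4:
  fixes M :: "'w measure"
    and \<Lambda>\<^sub>l \<Lambda>\<^sub>v \<theta>\<^sub>0 :: real
    and L :: "nat \<Rightarrow> 'w \<Rightarrow> real \<times> real"
    and V :: "nat \<Rightarrow> 'w \<Rightarrow> real set"
  assumes "line_cox_network M \<Lambda>\<^sub>l \<Lambda>\<^sub>v L V"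
  shows "(\<forall>r>0. \<forall>k. has_cond_prob_at M (served_by_typical_line M \<theta>\<^sub>0 L V) (serving_distance \<theta>\<^sub>0 L V) r
           (\<lambda>\<omega>. num_lines L r \<omega> = k) (line_count_pmf \<Lambda>\<^sub>l \<Lambda>\<^sub>v r k))
         \<and> (\<forall>k. is_cond_prob_version M (served_by_typical_line M \<theta>\<^sub>0 L V) (serving_distance \<theta>\<^sub>0 L V)
           (\<lambda>r \<omega>. num_lines L r \<omega> = k) (\<lambda>r. line_count_pmf \<Lambda>\<^sub>l \<Lambda>\<^sub>v r k))"
proof -
  interpret line_cox_network M \<Lambda>\<^sub>l \<Lambda>\<^sub>v L V by (rule assms)
  show ?thesis using has_cond_prob_at_line_count is_cond_prob_version_line_count by blast
qed

end
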